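(* Let $(V,F^\bullet V,Q)$ be a complete $L_\infty$ algebra and let $f_1:W[1]\to V[1]$, $g_1:V[1]\to W[1]$, $K:V[1]\to V[1]$ be a complete contraction with differential $d_{V[1]}=q_1$ on $V[1]$. Let $R$ be the transferred complete $L_\infty$ algebra structure on $W$, and let $F:(W,R)\to(V,Q)$ and $G:(V,Q)\to(W,R)$ be the continuous $L_\infty$ morphisms with linear parts $f_1$ and $g_1$ given by homotopy transfer. Then the correspondence $$\rho:\mathrm{MC}(V)\to\mathrm{MC}(W)\times K(V^1),\qquad x\mapsto(\mathrm{MC}(G)(x),K(x))$$ is bijective. The inverse $\rho^{-1}$ admits the following recursive construction: given $y\in\mathrm{MC}(W)$ and $K(v)\in K(V^1)$, define a sequence of elements $x_n\in V^1$, $n\ge0$, by $x_0=0$ and $$x_{n+1}=f_1(y)-q_1K(v)+\sum_{i\ge2}\frac1{i!}\left(Kq_i-f_1g_i\right)\left(x_n^{\odot i}\right).$$ This sequence converges (with respect to the complete topology induced by the filtration on $V$) to a well defined $x\in V^1$, and $\rho^{-1}(y,K(v))=x$. Finally, $\rho^{-1}(-,0)$ coincides with $\mathrm{MC}(F):\mathrm{MC}(W)\to\mathrm{MC}(V)$, which induces a bijective correspondence between the sets $\mathrm{MC}(W)$ and $\operatorname{Ker}K\cap\mathrm{MC}(V)$, whose inverse is the restriction of $g_1$.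
   Context: Fix a field of characteristic zero. Graded spaces are $\mathbb Z$-graded, $V[1]^k=V^{k+1}$, differentials have degree $+1$, and $V^{\odot n}$ is the $n$-th symmetric power with Koszul signs $\varepsilon(\sigma)$. Elements of $V$ and of $V[1]$ are denoted by the same symbols (so e.g. $K$ is applied to $V^1=V[1]^0$). **$L_\infty$ algebras.** An $L_\infty$ algebra $(V,Q)$ is a graded space $V$ with degree one maps $q_i:V[1]^{\odot i}\to V[1]$, $i\ge1$, such that the coderivation $Q$ of the reduced symmetric coalgebra $\overline S(V[1])=\bigoplus_{n\ge1}V[1]^{\odot n}$ (unshuffle coproduct) given by $Q(v_1\odot\cdots\odot v_n)=\sum_{i=1}^n\sum_{\sigma\in S(i,n-i)}\varepsilon(\sigma)q_i(v_{\sigma(1)}\odot\cdots\odot v_{\sigma(i)})\odot v_{\sigma(i+1)}\odot\cdots\odot v_{\sigma(n)}$ satisfies $Q^2=0$; here $S(\cdots)$ denotes sets of unshuffles. An $L_\infty$ morphism $F:(W,R)\to(V,Q)$ is a family of degree zero maps $f_i:W[1]^{\odot i}\to V[1]$, $i\ge1$, such that the coalgebra morphism $F:\overline S(W[1])\to\overline S(V[1])$ whose components $F_i^k:W[1]^{\odot i}\to V[1]^{\odot k}$ are $F_i^k(w_1\odot\cdots\odot w_i)=\frac1{k!}\sum_{i_1+\cdots+i_k=i,\,i_j\ge1}\sum_{\sigma\in S(i_1,\dots,i_k)}\varepsilon(\sigma)f_{i_1}(w_{\sigma(1)}\odot\cdots)\odot\cdots\odot f_{i_k}(\cdots\odot w_{\sigma(i)})$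 satisfies $FR=QF$; $f_1$ is its linear part. $(V,F^\bullet V,Q)$ is complete if $V=F^1V\supset F^2V\supset\cdots$ is a filtration with $V\cong\varprojlim V/F^pV$ and $q_i(F^{p_1}V[1]\odot\cdots\odot F^{p_i}V[1])\subset F^{p_1+\cdots+p_i}V[1]$; an $L_\infty$ morphism is continuous if its $f_i$ satisfy the analogous condition. **Maurer-Cartan sets.** $\mathrm{MC}(V)=\{x\in V^1:\sum_{i\ge1}\frac1{i!}q_i(x^{\odot i})=0\}$; a continuous $L_\infty$ morphism $F:W\to V$ induces $\mathrm{MC}(F):\mathrm{MC}(W)\to\mathrm{MC}(V)$, $x\mapsto\sum_{i\ge1}\frac1{i!}f_i(x^{\odot i})$. **Complete contractions.** A complete contraction consists of a dg space $(V,d_V)$ with a filtration $V=F^1V\supset F^2V\supset\cdots$, complete and preserved by $d_V$, a dg space $(W,d_W)$, dg morphisms $f:W\to V$, $g:V\to W$ and a degree $-1$ map $K:V\to V$ with $gf=\mathrm{id}_W$, $Kd_V+d_VK=fg-\mathrm{id}_V$, $Kf=K^2=gK=0$, and $K$, $fg$ preserving the filtration. $W$ is given the filtration $F^pW=f^{-1}(F^pV)$, with respect to which it is complete. (Above this is applied to $V[1]$, $W[1]$.) **Homotopy transfer.** Given a complete contraction $f_1,g_1,K$ between $W[1]$ and $V[1]$ and a complete $L_\infty$ structure $Q$ on $V$ with $q_1=d_{V[1]}$, the transferred data are determined recursively by $r_1=d_{W[1]}$ and, for $i\ge2$: $f_i=\sum_{k=2}^iKq_kF^k_i$, $\ r_i=\sum_{k=2}^ig_1q_kF^k_i$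 (where $F^k_i$ depends only on $f_1,\dots,f_{i-k+1}$), and $g_i=\sum_{k=1}^{i-1}g_kQ^k_iK_i$, where $Q^k_i:V[1]^{\odot i}\to V[1]^{\odot k}$ is the component of $Q$ and $$K_i(v_1\odot\cdots\odot v_i)=\frac1{i!}\sum_{\sigma\in S_i}\sum_{j=1}^i\pm f_1g_1(v_{\sigma(1)})\odot\cdots\odot f_1g_1(v_{\sigma(j-1)})\odot K(v_{\sigma(j)})\odot v_{\sigma(j+1)}\odot\cdots\odot v_{\sigma(i)}$$ with $\pm$ the Koszul sign (taking $|K|=-1$ into account). The homotopy transfer theorem says that $R=(r_i)$ is a complete $L_\infty$ structure on $W$ and that $F=(f_i)$, $G=(g_i)$ are continuous $L_\infty$ morphisms. *)

theory Defs
  imports Complex_Main "HOL-Library.Poly_Mapping" "HOL-Combinatorics.Permutations"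
begin

section \<open>Graded spaces\<close>

text \<open>
  A graded space over the field \<open>'k\<close> is given by its homogeneous components \<open>V k\<close>, realised as
  independent subspaces of an ambient vector space (for instance of their direct sum).  No
  element outside of the components is ever used, and linear maps matter only on the components.
\<close>

definition graded_space ::
    "('k::field \<Rightarrow> 'v::ab_group_add \<Rightarrow> 'v) \<Rightarrow> (int \<Rightarrow> 'v set) \<Rightarrow> bool" where
  "graded_space s V \<longleftrightarrow>
     vector_space s \<and> (\<forall>k. module.subspace s (V k)) \<and>
     (\<forall>S x. finite S \<and> (\<forall>k\<in>S. x k \<in> V k) \<and> (\<Sum>k\<in>S. x k) = 0 \<longrightarrow> (\<forall>k\<in>S. x k = 0))"

text \<open>\<open>shift V\<close> is \<open>V[1]\<close>.\<close>

definition shift :: "(int \<Rightarrow> 'v set) \<Rightarrow> int \<Rightarrow> 'v set" where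
  "shift V k = V (k + 1)"

definition graded_linear ::
    "('k \<Rightarrow> 'v::ab_group_add \<Rightarrow> 'v) \<Rightarrow> (int \<Rightarrow> 'v set) \<Rightarrow>
     ('k \<Rightarrow> 'w::ab_group_add \<Rightarrow> 'w) \<Rightarrow> (int \<Rightarrow> 'w set) \<Rightarrow> int \<Rightarrow> ('v \<Rightarrow> 'w) \<Rightarrow> bool" where
  "graded_linear sV V sW W e m \<longleftrightarrow>
     (\<forall>k. \<forall>x\<in>V k. m x \<in> W (k + e)) \<and>
     (\<forall>k a b. \<forall>x\<in>V k. \<forall>y\<in>V k. m (sV a x + sV b y) = sW a (m x) + sW b (m y))"

definition dg_space ::
    "('k::field \<Rightarrow> 'v::ab_group_add \<Rightarrow> 'v) \<Rightarrow> (int \<Rightarrow> 'v set) \<Rightarrow> ('v \<Rightarrow> 'v) \<Rightarrow> bool" where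
  "dg_space s V d \<longleftrightarrow>
     graded_space s V \<and> graded_linear s V s V 1 d \<and> (\<forall>k. \<forall>x\<in>V k. d (d x) = 0)"


section \<open>Complete filtrations\<close>

text \<open>
  A filtration \<open>F p k = F\<^sup>p V\<^sup>k\<close> is indexed by \<open>p \<ge> 1\<close>; the value at \<open>p = 0\<close> is irrelevant.
  The last clause says that the canonical map from \<open>V\<^sup>k\<close> to the inverse limit of the
  \<open>V\<^sup>k / F\<^sup>p V\<^sup>k\<close> is bijective: a point of the limit is represented by elements \<open>c p\<close> with
  \<open>c (p + 1) - c p \<in> F\<^sup>p V\<^sup>k\<close>.
\<close>

definition complete_filtration ::
    "('k::field \<Rightarrow> 'v::ab_group_add \<Rightarrow> 'v) \<Rightarrow> (int \<Rightarrow> 'v set) \<Rightarrow>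
     (nat \<Rightarrow> int \<Rightarrow> 'v set) \<Rightarrow> bool" where
  "complete_filtration s V F \<longleftrightarrow>
     F 1 = V \<and>
     (\<forall>p\<ge>1. \<forall>k. module.subspace s (F p k) \<and> F (Suc p) k \<subseteq> F p k) \<and>
     (\<forall>k c. (\<forall>p\<ge>1. c p \<in> V k \<and> c (Suc p) - c p \<in> F p k) \<longrightarrow>
            (\<exists>!x. x \<in> V k \<and> (\<forall>p\<ge>1. x - c p \<in> F p k)))"

definition filt_tendsto ::
    "(nat \<Rightarrow> int \<Rightarrow> 'v::ab_group_add set) \<Rightarrow> int \<Rightarrow> (nat \<Rightarrow> 'v) \<Rightarrow> 'v \<Rightarrow> bool" where
  "filt_tendsto F k X x \<longleftrightarrow> (\<forall>p\<ge>1. \<forall>\<^sub>F n in sequentially. X n - x \<in> F p k)"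

text \<open>The sum of \<open>t i\<close> over \<open>i \<ge> m\<close> in degree \<open>k\<close>; recall that \<open>F 1 k\<close> is the whole component.\<close>

definition filt_sum ::
    "(nat \<Rightarrow> int \<Rightarrow> 'v::ab_group_add set) \<Rightarrow> int \<Rightarrow> nat \<Rightarrow> (nat \<Rightarrow> 'v) \<Rightarrow> 'v" where
  "filt_sum F k m t = (THE s. s \<in> F 1 k \<and> filt_tendsto F k (\<lambda>n. \<Sum>i=m..n. t i) s)"


section \<open>Symmetric powers\<close>

text \<open>
  A letter is a homogeneous element together with its degree (so that a degree is attached to
  zero as well), and a word \<open>[v\<^sub>1, \<dots>, v\<^sub>n]\<close> stands for \<open>v\<^sub>1 \<odot> \<dots> \<odot> v\<^sub>n\<close>.
  Elements of the symmetric powers are represented by formal linear combinations of words,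
  and equality in the symmetric powers is the congruence \<open>sym_eq\<close> modulo multilinearity and
  graded symmetry.
\<close>

type_synonym 'v word = "(int \<times> 'v) list"
type_synonym ('v, 'k) tensor = "'v word \<Rightarrow>\<^sub>0 'k"

definition words :: "(int \<Rightarrow> 'v set) \<Rightarrow> 'v word set" where
  "words V = {ws. \<forall>(d, v)\<in>set ws. v \<in> V d}"

definition deg :: "'v word \<Rightarrow> int" where
  "deg ws = sum_list (map fst ws)"

text \<open>
  \<open>v\<^sub>1 \<odot> \<dots> \<odot> v\<^sub>n = \<epsilon>(\<sigma>) v\<^bsub>\<sigma>(1)\<^esub> \<odot> \<dots> \<odot> v\<^bsub>\<sigma>(n)\<^esub>\<close>; positions are counted from 0, and
  \<open>permute_list \<sigma> ws\<close> is the word of the \<open>ws ! \<sigma> j\<close>.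
\<close>

definition koszul_sign :: "'v word \<Rightarrow> (nat \<Rightarrow> nat) \<Rightarrow> 'k::comm_ring_1" where
  "koszul_sign ws \<sigma> =
     (\<Prod>(i, j)\<in>{(i, j). i < j \<and> j < length ws \<and> \<sigma> j < \<sigma> i}.
        if odd (fst (ws ! \<sigma> i)) \<and> odd (fst (ws ! \<sigma> j)) then - 1 else 1)"

definition tscale :: "'k::comm_ring_1 \<Rightarrow> ('v, 'k) tensor \<Rightarrow> ('v, 'k) tensor" where
  "tscale c t = Poly_Mapping.map ((*) c) t"

text \<open>The linear extension of a map on words, with \<open>s\<close> the scalar multiplication of the target.\<close>

definition lin_ext ::
    "('k::zero \<Rightarrow> 'b \<Rightarrow> 'b::ab_group_add) \<Rightarrow> ('v word \<Rightarrow> 'b) \<Rightarrow> ('v, 'k) tensor \<Rightarrow> 'b" where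
  "lin_ext s \<phi> t = (\<Sum>w\<in>Poly_Mapping.keys t. s (Poly_Mapping.lookup t w) (\<phi> w))"

definition sym_relations ::
    "('k::field \<Rightarrow> 'v::ab_group_add \<Rightarrow> 'v) \<Rightarrow> (int \<Rightarrow> 'v set) \<Rightarrow> ('v, 'k) tensor set" where
  "sym_relations s V =
     {Poly_Mapping.single (xs @ (d, s a x + s b y) # ys) 1
        - Poly_Mapping.single (xs @ (d, x) # ys) a
        - Poly_Mapping.single (xs @ (d, y) # ys) b
      | xs ys d x y a b. xs \<in> words V \<and> ys \<in> words V \<and> x \<in> V d \<and> y \<in> V d} \<union>
     {Poly_Mapping.single ws 1 - Poly_Mapping.single (permute_list \<sigma> ws) (koszul_sign ws \<sigma>)
      | ws \<sigma>. ws \<in> words V \<and> \<sigma> permutes {..<length ws}}"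

definition sym_eq ::
    "('k::field \<Rightarrow> 'v::ab_group_add \<Rightarrow> 'v) \<Rightarrow> (int \<Rightarrow> 'v set) \<Rightarrow>
     ('v, 'k) tensor \<Rightarrow> ('v, 'k) tensor \<Rightarrow> bool" where
  "sym_eq s V t u \<longleftrightarrow> t - u \<in> module.span tscale (sym_relations s V)"

text \<open>
  A family of degree \<open>e\<close> linear maps \<open>V\<^sup>\<odot>\<^sup>i \<rightarrow> W\<close>, \<open>i \<ge> 1\<close>, is given by graded symmetric multilinear
  maps, the \<open>i\<close>-th of which is the restriction of \<open>m\<close> to lists of length \<open>i\<close>.
\<close>

definition sym_family ::
    "('k::field \<Rightarrow> 'v::ab_group_add \<Rightarrow> 'v) \<Rightarrow> (int \<Rightarrow> 'v set) \<Rightarrow>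
     ('k \<Rightarrow> 'w::ab_group_add \<Rightarrow> 'w) \<Rightarrow> (int \<Rightarrow> 'w set) \<Rightarrow> int \<Rightarrow> ('v list \<Rightarrow> 'w) \<Rightarrow> bool" where
  "sym_family sV V sW W e m \<longleftrightarrow>
     (\<forall>ws\<in>words V. ws \<noteq> [] \<longrightarrow> m (map snd ws) \<in> W (deg ws + e)) \<and>
     (\<forall>xs\<in>words V. \<forall>ys\<in>words V. \<forall>d a b. \<forall>x\<in>V d. \<forall>y\<in>V d.
        m (map snd xs @ (sV a x + sV b y) # map snd ys) =
        sW a (m (map snd xs @ x # map snd ys)) + sW b (m (map snd xs @ y # map snd ys))) \<and>
     (\<forall>ws\<in>words V. \<forall>\<sigma>. ws \<noteq> [] \<and> \<sigma> permutes {..<length ws} \<longrightarrow>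
        m (map snd ws) = sW (koszul_sign ws \<sigma>) (m (map snd (permute_list \<sigma> ws))))"

text \<open>The value on a tensor (a combination of nonempty words) of the linear map given by \<open>m\<close>.\<close>

definition sym_apply ::
    "('k::zero \<Rightarrow> 'w \<Rightarrow> 'w::ab_group_add) \<Rightarrow> ('v list \<Rightarrow> 'w) \<Rightarrow> ('v, 'k) tensor \<Rightarrow> 'w" where
  "sym_apply s m = lin_ext s (\<lambda>w. m (map snd w))"

definition filtered_family ::
    "(int \<Rightarrow> 'v set) \<Rightarrow> (nat \<Rightarrow> int \<Rightarrow> 'v set) \<Rightarrow> (nat \<Rightarrow> int \<Rightarrow> 'w set) \<Rightarrow> int \<Rightarrow>
     ('v list \<Rightarrow> 'w) \<Rightarrow> bool" where
  "filtered_family V F F' e m \<longleftrightarrow>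
     (\<forall>ws\<in>words V. \<forall>ps. ws \<noteq> [] \<and> length ps = length ws \<and>
        (\<forall>j<length ws. 1 \<le> ps ! j \<and> snd (ws ! j) \<in> F (ps ! j) (fst (ws ! j))) \<longrightarrow>
        m (map snd ws) \<in> F' (sum_list ps) (deg ws + e))"


section \<open>Coderivations and coalgebra morphisms\<close>

text \<open>
  \<open>unshuffles [i\<^sub>1, \<dots>, i\<^sub>k]\<close> is \<open>S(i\<^sub>1, \<dots>, i\<^sub>k)\<close>: the permutations that are increasing on each
  of the consecutive blocks of lengths \<open>i\<^sub>1, \<dots>, i\<^sub>k\<close>.
\<close>

definition unshuffles :: "nat list \<Rightarrow> (nat \<Rightarrow> nat) set" where
  "unshuffles is =
     {\<sigma>. \<sigma> permutes {..<sum_list is} \<and>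
         (\<forall>j<length is. strict_mono_on {sum_list (take j is)..<sum_list (take (Suc j) is)} \<sigma>)}"

fun blocks :: "nat list \<Rightarrow> 'a list \<Rightarrow> 'a list list" where
  "blocks [] ws = []"
| "blocks (i # is) ws = take i ws # blocks is (drop i ws)"

text \<open>\<open>coder_part q i\<close> is the part of the coderivation \<open>Q\<close> (of degree 1) that involves \<open>q\<^sub>i\<close>.\<close>

definition coder_part ::
    "('v list \<Rightarrow> 'v) \<Rightarrow> nat \<Rightarrow> 'v word \<Rightarrow> ('v, 'k::field) tensor" where
  "coder_part q i ws =
     (\<Sum>\<sigma>\<in>unshuffles [i, length ws - i].
        let us = permute_list \<sigma> ws in
        Poly_Mapping.single
          ((deg (take i us) + 1, q (map snd (take i us))) # drop i us) (koszul_sign ws \<sigma>))"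

definition coder :: "('v list \<Rightarrow> 'v) \<Rightarrow> 'v word \<Rightarrow> ('v, 'k::field) tensor" where
  "coder q ws = (\<Sum>i=1..length ws. coder_part q i ws)"

text \<open>The component \<open>Q\<^sup>k\<^sub>n\<close> with values in the \<open>k\<close>-th symmetric power, where \<open>1 \<le> k \<le> n = length ws\<close>.\<close>

definition coder_comp :: "('v list \<Rightarrow> 'v) \<Rightarrow> nat \<Rightarrow> 'v word \<Rightarrow> ('v, 'k::field) tensor" where
  "coder_comp q k ws = coder_part q (length ws + 1 - k) ws"

text \<open>The component \<open>F\<^sup>k\<^sub>n\<close>, \<open>n = length ws\<close>, of the coalgebra morphism given by the \<open>f\<^sub>i\<close>.\<close>

definition mor_comp ::
    "('w list \<Rightarrow> 'v) \<Rightarrow> nat \<Rightarrow> 'w word \<Rightarrow> ('v, 'k::field_char_0) tensor" where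
  "mor_comp f k ws =
     (\<Sum>is\<in>{is. length is = k \<and> sum_list is = length ws \<and> (\<forall>i\<in>set is. 1 \<le> i)}.
      \<Sum>\<sigma>\<in>unshuffles is.
        Poly_Mapping.single
          (map (\<lambda>b. (deg b, f (map snd b))) (blocks is (permute_list \<sigma> ws)))
          (koszul_sign ws \<sigma> / fact k))"

definition mor :: "('w list \<Rightarrow> 'v) \<Rightarrow> 'w word \<Rightarrow> ('v, 'k::field_char_0) tensor" where
  "mor f ws = (\<Sum>k=1..length ws. mor_comp f k ws)"


section \<open>$L_\infty$ algebras and morphisms\<close>

definition Linf_algebra ::
    "('k::field_char_0 \<Rightarrow> 'v::ab_group_add \<Rightarrow> 'v) \<Rightarrow> (int \<Rightarrow> 'v set) \<Rightarrow> ('v list \<Rightarrow> 'v) \<Rightarrow> bool" where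
  "Linf_algebra s V q \<longleftrightarrow>
     graded_space s V \<and> sym_family s (shift V) s (shift V) 1 q \<and>
     (\<forall>ws\<in>words (shift V). ws \<noteq> [] \<longrightarrow>
        sym_eq s (shift V) (lin_ext tscale (coder q) (coder q ws)) 0)"

definition Linf_morphism ::
    "('k::field_char_0 \<Rightarrow> 'w::ab_group_add \<Rightarrow> 'w) \<Rightarrow> (int \<Rightarrow> 'w set) \<Rightarrow> ('w list \<Rightarrow> 'w) \<Rightarrow>
     ('k \<Rightarrow> 'v::ab_group_add \<Rightarrow> 'v) \<Rightarrow> (int \<Rightarrow> 'v set) \<Rightarrow> ('v list \<Rightarrow> 'v) \<Rightarrow>
     ('w list \<Rightarrow> 'v) \<Rightarrow> bool" where
  "Linf_morphism sW W r sV V q f \<longleftrightarrow>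
     sym_family sW (shift W) sV (shift V) 0 f \<and>
     (\<forall>ws\<in>words (shift W). ws \<noteq> [] \<longrightarrow>
        sym_eq sV (shift V) (lin_ext tscale (mor f) (coder r ws))
                            (lin_ext tscale (coder q) (mor f ws)))"

definition complete_Linf_algebra ::
    "('k::field_char_0 \<Rightarrow> 'v::ab_group_add \<Rightarrow> 'v) \<Rightarrow> (int \<Rightarrow> 'v set) \<Rightarrow>
     (nat \<Rightarrow> int \<Rightarrow> 'v set) \<Rightarrow> ('v list \<Rightarrow> 'v) \<Rightarrow> bool" where
  "complete_Linf_algebra s V F q \<longleftrightarrow>
     Linf_algebra s V q \<and> complete_filtration s V F \<and>
     filtered_family (shift V) (\<lambda>p. shift (F p)) (\<lambda>p. shift (F p)) 1 q"

definition continuous_Linf_morphism ::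
    "('k::field_char_0 \<Rightarrow> 'w::ab_group_add \<Rightarrow> 'w) \<Rightarrow> (int \<Rightarrow> 'w set) \<Rightarrow>
     (nat \<Rightarrow> int \<Rightarrow> 'w set) \<Rightarrow> ('w list \<Rightarrow> 'w) \<Rightarrow>
     ('k \<Rightarrow> 'v::ab_group_add \<Rightarrow> 'v) \<Rightarrow> (int \<Rightarrow> 'v set) \<Rightarrow>
     (nat \<Rightarrow> int \<Rightarrow> 'v set) \<Rightarrow> ('v list \<Rightarrow> 'v) \<Rightarrow> ('w list \<Rightarrow> 'v) \<Rightarrow> bool" where
  "continuous_Linf_morphism sW W FW r sV V FV q f \<longleftrightarrow>
     Linf_morphism sW W r sV V q f \<and>
     filtered_family (shift W) (\<lambda>p. shift (FW p)) (\<lambda>p. shift (FV p)) 0 f"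


section \<open>Maurer-Cartan sets\<close>

definition MC ::
    "('k::field_char_0 \<Rightarrow> 'v::ab_group_add \<Rightarrow> 'v) \<Rightarrow> (int \<Rightarrow> 'v set) \<Rightarrow>
     (nat \<Rightarrow> int \<Rightarrow> 'v set) \<Rightarrow> ('v list \<Rightarrow> 'v) \<Rightarrow> 'v set" where
  "MC s V F q =
     {x \<in> V 1. filt_tendsto F 2 (\<lambda>n. \<Sum>i=1..n. s (1 / fact i) (q (replicate i x))) 0}"

text \<open>Here \<open>s\<close> and \<open>F\<close> are the scalar multiplication and the filtration of the target.\<close>

definition MC_map ::
    "('k::field_char_0 \<Rightarrow> 'v::ab_group_add \<Rightarrow> 'v) \<Rightarrow> (nat \<Rightarrow> int \<Rightarrow> 'v set) \<Rightarrow>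
     ('w list \<Rightarrow> 'v) \<Rightarrow> 'w \<Rightarrow> 'v" where
  "MC_map s F f x = filt_sum F 1 1 (\<lambda>i. s (1 / fact i) (f (replicate i x)))"


section \<open>Complete contractions and homotopy transfer\<close>

definition complete_contraction ::
    "('k::field \<Rightarrow> 'v::ab_group_add \<Rightarrow> 'v) \<Rightarrow> (int \<Rightarrow> 'v set) \<Rightarrow>
     (nat \<Rightarrow> int \<Rightarrow> 'v set) \<Rightarrow> ('v \<Rightarrow> 'v) \<Rightarrow>
     ('k \<Rightarrow> 'w::ab_group_add \<Rightarrow> 'w) \<Rightarrow> (int \<Rightarrow> 'w set) \<Rightarrow> ('w \<Rightarrow> 'w) \<Rightarrow>
     ('w \<Rightarrow> 'v) \<Rightarrow> ('v \<Rightarrow> 'w) \<Rightarrow> ('v \<Rightarrow> 'v) \<Rightarrow> bool" where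
  "complete_contraction sV V F dV sW W dW f g K \<longleftrightarrow>
     dg_space sV V dV \<and> complete_filtration sV V F \<and>
     (\<forall>p\<ge>1. \<forall>k. \<forall>x\<in>F p k. dV x \<in> F p (k + 1)) \<and>
     dg_space sW W dW \<and>
     graded_linear sW W sV V 0 f \<and> (\<forall>k. \<forall>w\<in>W k. f (dW w) = dV (f w)) \<and>
     graded_linear sV V sW W 0 g \<and> (\<forall>k. \<forall>x\<in>V k. g (dV x) = dW (g x)) \<and>
     graded_linear sV V sV V (- 1) K \<and>
     (\<forall>k. \<forall>w\<in>W k. g (f w) = w) \<and>
     (\<forall>k. \<forall>x\<in>V k. K (dV x) + dV (K x) = f (g x) - x) \<and>
     (\<forall>k. \<forall>w\<in>W k. K (f w) = 0) \<and>
     (\<forall>k. \<forall>x\<in>V k. K (K x) = 0 \<and> g (K x) = 0) \<and>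
     (\<forall>p\<ge>1. \<forall>k. \<forall>x\<in>F p k. K x \<in> F p (k - 1) \<and> f (g x) \<in> F p k)"

definition pullback_filtration ::
    "(int \<Rightarrow> 'w set) \<Rightarrow> (nat \<Rightarrow> int \<Rightarrow> 'v set) \<Rightarrow> ('w \<Rightarrow> 'v) \<Rightarrow> nat \<Rightarrow> int \<Rightarrow> 'w set" where
  "pullback_filtration W F f p k = {w \<in> W k. f w \<in> F p k}"

text \<open>
  The map \<open>K\<^sub>i\<close> on the \<open>i\<close>-th symmetric power, with \<open>h = f\<^sub>1 g\<^sub>1\<close>.  Since \<open>K\<close> is odd, moving it past
  the letters in front of it contributes the sign of the sum of their degrees.
\<close>

definition sym_homotopy ::
    "('v \<Rightarrow> 'v) \<Rightarrow> ('v \<Rightarrow> 'v) \<Rightarrow> 'v word \<Rightarrow> ('v, 'k::field_char_0) tensor" where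
  "sym_homotopy h K ws =
     (\<Sum>\<sigma>\<in>{\<sigma>. \<sigma> permutes {..<length ws}}. \<Sum>j<length ws.
        let us = permute_list \<sigma> ws in
        Poly_Mapping.single
          (map (apsnd h) (take j us) @ (fst (us ! j) - 1, K (snd (us ! j))) # drop (Suc j) us)
          (koszul_sign ws \<sigma> * (if odd (deg (take j us)) then - 1 else 1) / fact (length ws)))"

text \<open>
  The equations that recursively determine the transferred \<open>r\<close>, \<open>f\<close>, \<open>g\<close> (on homogeneous elements)
  from \<open>q\<close> and the contraction \<open>f1\<close>, \<open>g1\<close>, \<open>K\<close> between \<open>W[1]\<close>, with differential \<open>dW\<close>, and \<open>V[1]\<close>.
\<close>

definition homotopy_transfer ::
    "('k::field_char_0 \<Rightarrow> 'v::ab_group_add \<Rightarrow> 'v) \<Rightarrow> (int \<Rightarrow> 'v set) \<Rightarrow> ('v list \<Rightarrow> 'v) \<Rightarrow>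
     ('k \<Rightarrow> 'w::ab_group_add \<Rightarrow> 'w) \<Rightarrow> (int \<Rightarrow> 'w set) \<Rightarrow> ('w \<Rightarrow> 'w) \<Rightarrow>
     ('w \<Rightarrow> 'v) \<Rightarrow> ('v \<Rightarrow> 'w) \<Rightarrow> ('v \<Rightarrow> 'v) \<Rightarrow>
     ('w list \<Rightarrow> 'w) \<Rightarrow> ('w list \<Rightarrow> 'v) \<Rightarrow> ('v list \<Rightarrow> 'w) \<Rightarrow> bool" where
  "homotopy_transfer sV V q sW W dW f1 g1 K r f g \<longleftrightarrow>
     (\<forall>k. \<forall>w\<in>shift W k. r [w] = dW w \<and> f [w] = f1 w) \<and>
     (\<forall>k. \<forall>v\<in>shift V k. g [v] = g1 v) \<and>
     (\<forall>ws\<in>words (shift W). 2 \<le> length ws \<longrightarrow>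
        f (map snd ws) = (\<Sum>k=2..length ws. K (sym_apply sV q (mor_comp f k ws))) \<and>
        r (map snd ws) = (\<Sum>k=2..length ws. g1 (sym_apply sV q (mor_comp f k ws)))) \<and>
     (\<forall>vs\<in>words (shift V). 2 \<le> length vs \<longrightarrow>
        g (map snd vs) =
          (\<Sum>k=1..length vs - 1.
             sym_apply sW g
               (lin_ext tscale (coder_comp q k) (sym_homotopy (\<lambda>v. f1 (g1 v)) K vs))))"

text \<open>The sequence \<open>x\<^sub>n\<close> for \<open>y\<close> and \<open>u = K v\<close>.\<close>

primrec MC_iteration ::
    "('k::field_char_0 \<Rightarrow> 'v::ab_group_add \<Rightarrow> 'v) \<Rightarrow> (nat \<Rightarrow> int \<Rightarrow> 'v set) \<Rightarrow> ('v list \<Rightarrow> 'v) \<Rightarrow>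
     ('w \<Rightarrow> 'v) \<Rightarrow> ('v \<Rightarrow> 'v) \<Rightarrow> ('v list \<Rightarrow> 'w) \<Rightarrow> 'w \<Rightarrow> 'v \<Rightarrow> nat \<Rightarrow> 'v" where
  "MC_iteration s F q f1 K g y u 0 = 0"
| "MC_iteration s F q f1 K g y u (Suc n) =
     f1 y - q [u] +
     filt_sum F 1 2 (\<lambda>i. s (1 / fact i)
       (K (q (replicate i (MC_iteration s F q f1 K g y u n))) -
        f1 (g (replicate i (MC_iteration s F q f1 K g y u n)))))"

end

theory Submission
  imports Defs "HOL-Library.Infinite_Set"
begin

text \<open>
  Let \<open>c(x) = \<Sum>\<^sub>i q\<^sub>i(x\<^sup>i)/i!\<close> be the curvature. By the homotopy formula for \<open>K\<close>, a
  Maurer-Cartan element \<open>x\<close> with \<open>\<rho>(x) = (y, u)\<close> is a fixed point of the map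
  \<open>x \<mapsto> f\<^sub>1(y) - q\<^sub>1(u) + \<Sum>\<^sub>i\<^sub>\<ge>\<^sub>2 (K q\<^sub>i - f\<^sub>1 g\<^sub>i)(x\<^sup>i)/i!\<close>, which is a contraction for the
  filtration and thus has exactly one fixed point. Conversely the side conditions give
  \<open>\<rho>(x) = (y, u)\<close> and \<open>K c(x) = 0\<close> for the fixed point. The Bianchi identity
  \<open>\<Sum>\<^sub>n q\<^sub>n\<^sub>+\<^sub>1(c(x), x\<^sup>n)/n! = 0\<close> and its analogue for the morphism \<open>G\<close> then move \<open>c(x)\<close> from
  \<open>F\<^sup>p\<close> to \<open>F\<^sup>p\<^sup>+\<^sup>1\<close> for all \<open>p\<close>, so \<open>c(x) = 0\<close>. These identities are used only as congruences
  modulo a step of the filtration, so that all sums are finite.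

  On \<open>Ker K\<close> the higher \<open>g\<^sub>i\<close> vanish on powers of \<open>x\<close>, while the higher \<open>f\<^sub>i\<close> have values in the
  image of \<open>K\<close>, on which \<open>K\<close> and \<open>g\<^sub>1\<close> vanish; hence \<open>\<rho>(MC(F)(y)) = (y, 0)\<close>.
\<close>

section \<open>Counting unshuffles\<close>

text \<open>Both maps list the same finite set in increasing order, and a set has only one sorted
  list without repetitions.\<close>

lemma strict_mono_on_eq_if_image_eq:
  fixes \<sigma> \<tau> :: "nat \<Rightarrow> nat"
  assumes "strict_mono_on {a..<b} \<sigma>" "strict_mono_on {a..<b} \<tau>"
    and "\<sigma> ` {a..<b} = \<tau> ` {a..<b}" and "i \<in> {a..<b}"
  shows "\<sigma> i = \<tau> i"
proof -
  have *: "sorted (map \<rho> [a..<b]) \<and> distinct (map \<rho> [a..<b])"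
    if "strict_mono_on {a..<b} \<rho>" for \<rho> :: "nat \<Rightarrow> nat"
  proof
    show "sorted (map \<rho> [a..<b])"
      unfolding sorted_iff_nth_mono_less
      by (auto intro!: less_imp_le strict_mono_onD[OF that])
    show "distinct (map \<rho> [a..<b])"
      using strict_mono_on_imp_inj_on[OF that] by (simp add: distinct_map)
  qed
  have "map \<sigma> [a..<b] = map \<tau> [a..<b]"
    using *[OF assms(1)] *[OF assms(2)] assms(3) by (intro sorted_distinct_set_unique) auto
  then show ?thesis
    using assms(4) by (simp add: map_eq_conv)
qed

text \<open>Let \<open>h\<close> enumerate the image of the block increasingly. Sending the i-th
  position of the block to the preimage of the i-th value of \<open>h\<close> turns
  \<open>\<pi>\<close> into \<open>h\<close> up to a translation of the argument.\<close>

lemma ex_sorting_permutation: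
  fixes \<pi> :: "nat \<Rightarrow> nat"
  assumes "inj_on \<pi> {a..<b}"
  obtains \<tau> where "\<tau> permutes {a..<b}" "strict_mono_on {a..<b} (\<pi> \<circ> \<tau>)"
proof -
  let ?B = "{a..<b}"
  have card: "card (\<pi> ` ?B) = b - a"
    using assms by (simp add: card_image)
  obtain h where h: "bij_betw h {..<b - a} (\<pi> ` ?B)" "strict_mono_on {..<b - a} h"
    using ex_bij_betw_strict_mono_card[of "\<pi> ` ?B"] card by (metis finite_atLeastLessThan finite_imageI)
  define \<tau> where "\<tau> i = (if i \<in> ?B then inv_into ?B \<pi> (h (i - a)) else i)" for i
  have shift: "bij_betw (\<lambda>i. i - a) ?B {..<b - a}"
    by (intro bij_betw_byWitness[where f' = "\<lambda>i. i + a"]) auto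
  have "bij_betw (inv_into ?B \<pi> \<circ> (h \<circ> (\<lambda>i. i - a))) ?B ?B"
    using bij_betw_inv_into[of \<pi> ?B "\<pi> ` ?B"] assms
    by (intro bij_betw_trans[OF bij_betw_trans[OF shift h(1)]]) (auto simp: bij_betw_def)
  then have "bij_betw \<tau> ?B ?B"
    by (rule bij_betw_cong[THEN iffD1, rotated]) (simp add: \<tau>_def)
  then have "\<tau> permutes ?B"
    by (intro bij_imp_permutes) (auto simp: \<tau>_def)
  moreover have "\<pi> (\<tau> i) = h (i - a)" if "i \<in> ?B" for i
  proof -
    have "h (i - a) \<in> \<pi> ` ?B"
      using h(1) that by (auto simp: bij_betw_def)
    then show ?thesis
      using that by (simp add: \<tau>_def f_inv_into_f)
  qed
  then have "strict_mono_on ?B (\<pi> \<circ> \<tau>)"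
    by (auto simp: strict_mono_on_def intro!: strict_mono_onD[OF h(2)])
  ultimately show ?thesis
    by (rule that)
qed

text \<open>Sorting the values on the block factors each permutation uniquely into one that
  increases there and a permutation of the block. The invariance of \<open>P\<close> keeps the first
  factor inside the counted set.\<close>

lemma card_permutations_sorted_on_block:
  fixes S :: "nat set"
  assumes "finite S" "{a..<b} \<subseteq> S"
    and inv: "\<And>\<sigma> \<tau>. \<tau> permutes {a..<b} \<Longrightarrow> P (\<sigma> \<circ> \<tau>) \<longleftrightarrow> P \<sigma>"
  shows "card {\<sigma>. \<sigma> permutes S \<and> P \<sigma>} =
         card {\<sigma>. \<sigma> permutes S \<and> P \<sigma> \<and> strict_mono_on {a..<b} \<sigma>} * fact (b - a)"
proof -
  let ?B = "{a..<b}"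
  let ?X = "{\<sigma>. \<sigma> permutes S \<and> P \<sigma> \<and> strict_mono_on ?B \<sigma>}"
  have "bij_betw (\<lambda>(\<sigma>, \<tau>). \<sigma> \<circ> \<tau>) (?X \<times> {\<tau>. \<tau> permutes ?B}) {\<sigma>. \<sigma> permutes S \<and> P \<sigma>}"
  proof (intro bij_betw_imageI inj_onI)
    fix x y
    assume "x \<in> ?X \<times> {\<tau>. \<tau> permutes ?B}" "y \<in> ?X \<times> {\<tau>. \<tau> permutes ?B}"
      and eq: "(case x of (\<sigma>, \<tau>) \<Rightarrow> \<sigma> \<circ> \<tau>) = (case y of (\<sigma>, \<tau>) \<Rightarrow> \<sigma> \<circ> \<tau>)"
    then obtain \<sigma> \<tau> \<sigma>' \<tau>' where xy: "x = (\<sigma>, \<tau>)" "y = (\<sigma>', \<tau>')"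
      and \<sigma>: "\<sigma> permutes S" "strict_mono_on ?B \<sigma>" and \<sigma>': "strict_mono_on ?B \<sigma>'"
      and \<tau>: "\<tau> permutes ?B" "\<tau>' permutes ?B"
      by auto
    have eq': "\<sigma> (\<tau> i) = \<sigma>' (\<tau>' i)" for i
      using fun_cong[OF eq, of i] xy by simp
    \<comment> \<open>Rearranging the block does not change its image, so the two increasing factors
      have the same image there and must agree.\<close>
    have "\<sigma> ` ?B = (\<lambda>i. \<sigma> (\<tau> i)) ` ?B" "\<sigma>' ` ?B = (\<lambda>i. \<sigma>' (\<tau>' i)) ` ?B"
      using permutes_image[OF \<tau>(1)] permutes_image[OF \<tau>(2)] by (metis image_image)+
    then have "\<sigma> ` ?B = \<sigma>' ` ?B"
      using eq' by simp
    then have "\<sigma> i = \<sigma>' i" if "i \<in> ?B" for i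
      using strict_mono_on_eq_if_image_eq[OF \<sigma>(2) \<sigma>' _ that] by simp
    moreover have "\<sigma> i = \<sigma>' i" if "i \<notin> ?B" for i
      using eq'[of i] that \<tau> by (simp add: permutes_not_in)
    ultimately have "\<sigma> = \<sigma>'"
      by blast
    moreover have "\<tau> = \<tau>'"
      using eq' \<open>\<sigma> = \<sigma>'\<close> permutes_inj[OF \<sigma>(1)] by (auto simp: inj_eq)
    ultimately show "x = y"
      using xy by simp
  next
    show "(\<lambda>(\<sigma>, \<tau>). \<sigma> \<circ> \<tau>) ` (?X \<times> {\<tau>. \<tau> permutes ?B}) = {\<sigma>. \<sigma> permutes S \<and> P \<sigma>}"
    proof (intro equalityI subsetI)
      fix \<pi> assume "\<pi> \<in> (\<lambda>(\<sigma>, \<tau>). \<sigma> \<circ> \<tau>) ` (?X \<times> {\<tau>. \<tau> permutes ?B})"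
      then show "\<pi> \<in> {\<sigma>. \<sigma> permutes S \<and> P \<sigma>}"
        using inv permutes_subset[OF _ assms(2)] by (auto intro!: permutes_compose)
    next
      fix \<pi> assume "\<pi> \<in> {\<sigma>. \<sigma> permutes S \<and> P \<sigma>}"
      then have \<pi>: "\<pi> permutes S" "P \<pi>"
        by auto
      obtain \<tau> where \<tau>: "\<tau> permutes ?B" "strict_mono_on ?B (\<pi> \<circ> \<tau>)"
        using ex_sorting_permutation[of \<pi> a b] permutes_inj[OF \<pi>(1)]
        by (metis inj_on_subset subset_UNIV)
      have "\<pi> = (\<pi> \<circ> \<tau>) \<circ> inv_into UNIV \<tau>"
        using permutes_inv_o[OF \<tau>(1)] by (simp add: comp_assoc)
      moreover have "\<pi> \<circ> \<tau> \<in> ?X"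
        using \<pi> \<tau> inv permutes_subset[OF \<tau>(1) assms(2)] by (auto intro!: permutes_compose)
      moreover have "inv_into UNIV \<tau> permutes ?B"
        using \<tau>(1) by (rule permutes_inv)
      ultimately show "\<pi> \<in> (\<lambda>(\<sigma>, \<tau>). \<sigma> \<circ> \<tau>) ` (?X \<times> {\<tau>. \<tau> permutes ?B})"
        by (intro image_eqI[of _ _ "(\<pi> \<circ> \<tau>, inv_into UNIV \<tau>)"]) auto
    qed
  qed
  from bij_betw_same_card[OF this] show ?thesis
    by (simp add: card_cartesian_product card_permutations[OF refl])
qed

lemma sum_list_take_mono:
  fixes ns :: "nat list"
  assumes "i \<le> j"
  shows "sum_list (take i ns) \<le> sum_list (take j ns)"
proof -
  have "take j ns = take i ns @ take (j - i) (drop i ns)"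
    using assms by (metis le_add_diff_inverse take_add)
  then show ?thesis
    by simp
qed

text \<open>The multinomial count, written as a product to avoid division of natural numbers. The
  induction imposes sortedness on one block after another, beginning with all permutations; block
  \<open>m\<close> divides the count by the factorial of its length.\<close>

lemma card_unshuffles: "card (unshuffles ns) * (\<Prod>i\<leftarrow>ns. fact i) = fact (sum_list ns)"
proof -
  let ?b = "\<lambda>j. {sum_list (take j ns)..<sum_list (take (Suc j) ns)}"
  let ?U = "\<lambda>m. {\<sigma>. \<sigma> permutes {..<sum_list ns} \<and> (\<forall>j<m. strict_mono_on (?b j) \<sigma>)}"
  have "card (?U m) * (\<Prod>i\<leftarrow>take m ns. fact i) = fact (sum_list ns)" if "m \<le> length ns" for m
    using that
  proof (induction m)
    case 0
    then show ?case
      by (simp add: card_permutations[OF refl])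
  next
    case (Suc m)
    have sub: "?b m \<subseteq> {..<sum_list ns}"
      using sum_list_take_mono[of "Suc m" "length ns" ns] Suc.prems by auto
    \<comment> \<open>A permutation of block \<open>m\<close> fixes every position in the earlier
      blocks, so it cannot affect whether these are sorted.\<close>
    have inv: "(\<forall>j<m. strict_mono_on (?b j) (\<sigma> \<circ> \<tau>)) \<longleftrightarrow> (\<forall>j<m. strict_mono_on (?b j) \<sigma>)"
      if "\<tau> permutes ?b m" for \<sigma> \<tau> :: "nat \<Rightarrow> nat"
    proof -
      have "(\<sigma> \<circ> \<tau>) i = \<sigma> i" if "j < m" "i \<in> ?b j" for i j
      proof -
        have "i \<notin> ?b m"
          using that sum_list_take_mono[of "Suc j" m ns] by auto
        then have "\<tau> i = i"
          using \<open>\<tau> permutes ?b m\<close> by (rule permutes_not_in[rotated])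
        then show ?thesis
          by simp
      qed
      then show ?thesis
        by (simp add: strict_mono_on_def)
    qed
    have len: "sum_list (take (Suc m) ns) - sum_list (take m ns) = ns ! m"
      and prod: "(\<Prod>i\<leftarrow>take (Suc m) ns. fact i) = (\<Prod>i\<leftarrow>take m ns. fact i) * (fact (ns ! m) :: nat)"
      using Suc.prems by (simp_all add: take_Suc_conv_app_nth)
    have "?U (Suc m) = {\<sigma>. \<sigma> permutes {..<sum_list ns} \<and> (\<forall>j<m. strict_mono_on (?b j) \<sigma>)
             \<and> strict_mono_on (?b m) \<sigma>}"
      by (auto simp: less_Suc_eq)
    then have "card (?U m) = card (?U (Suc m)) * fact (ns ! m)"
      using card_permutations_sorted_on_block[OF finite_lessThan sub inv] len by simp
    then show ?case
      using Suc unfolding prod by (simp add: mult_ac)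
  qed
  from this[of "length ns"] show ?thesis
    by (simp add: unshuffles_def)
qed

lemma of_nat_card_unshuffles:
  "(of_nat (card (unshuffles ns)) :: 'k::field_char_0) =
     fact (sum_list ns) / (\<Prod>i\<leftarrow>ns. fact i)"
proof -
  have [simp]: "of_nat (\<Prod>i\<leftarrow>ns. fact i) = (\<Prod>i\<leftarrow>ns. fact i :: 'k)" for ns :: "nat list"
    by (induction ns) auto
  have nz: "(\<Prod>i\<leftarrow>ns. fact i :: 'k) \<noteq> 0" for ns :: "nat list"
    by (induction ns) auto
  have "of_nat (card (unshuffles ns)) * (\<Prod>i\<leftarrow>ns. fact i :: 'k) = fact (sum_list ns)"
    using arg_cong[OF card_unshuffles[of ns], of "of_nat :: nat \<Rightarrow> 'k"] by simp
  then show ?thesis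
    using nz by (simp add: field_simps)
qed

lemma unshuffles_permutes: "\<sigma> \<in> unshuffles ns \<Longrightarrow> \<sigma> permutes {..<sum_list ns}"
  by (simp add: unshuffles_def)

lemma unshuffles_eq_id:
  assumes "card (unshuffles ns) = 1"
    and "\<And>j. j < length ns \<Longrightarrow> strict_mono_on {sum_list (take j ns)..<sum_list (take (Suc j) ns)} (id :: nat \<Rightarrow> nat)"
  shows "unshuffles ns = {id}"
proof -
  have "id \<in> unshuffles ns"
    using assms(2) by (simp add: unshuffles_def permutes_id)
  then show ?thesis
    using assms(1) by (metis card_1_singletonE singletonD)
qed

lemma unshuffles_singleton: "unshuffles [n] = {id}"
  using card_unshuffles[of "[n]"] by (intro unshuffles_eq_id) (auto simp: strict_mono_on_def)

lemma unshuffles_pair_zero: "unshuffles [n, 0] = {id}"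
  using card_unshuffles[of "[n, 0]"] by (intro unshuffles_eq_id) (auto simp: strict_mono_on_def)

section \<open>Linear extension to tensors\<close>

lemma lookup_tscale: "Poly_Mapping.lookup (tscale c t) w = c * Poly_Mapping.lookup t w"
  by (simp add: tscale_def map.rep_eq when_def)

lemma module_tscale: "module (tscale :: 'k::comm_ring_1 \<Rightarrow> ('v, 'k) tensor \<Rightarrow> ('v, 'k) tensor)"
  by unfold_locales (auto intro!: poly_mapping_eqI simp: lookup_tscale lookup_add algebra_simps)

context module
begin

text \<open>Sums over the supports of different tensors become comparable on a common finite set,
  since the added words have coefficient 0.\<close>

lemma lin_ext_superset:
  assumes "finite S" "Poly_Mapping.keys t \<subseteq> S"
  shows "lin_ext scale \<phi> t = (\<Sum>w\<in>S. scale (Poly_Mapping.lookup t w) (\<phi> w))"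
  unfolding lin_ext_def using assms
  by (intro sum.mono_neutral_left) (auto simp: in_keys_iff)

lemma lin_ext_add: "lin_ext scale \<phi> (t + u) = lin_ext scale \<phi> t + lin_ext scale \<phi> u"
proof -
  let ?S = "Poly_Mapping.keys t \<union> Poly_Mapping.keys u"
  have "lin_ext scale \<phi> (t + u) = (\<Sum>w\<in>?S. scale (Poly_Mapping.lookup (t + u) w) (\<phi> w))"
    by (intro lin_ext_superset) (auto simp: Poly_Mapping.keys_add)
  also have "\<dots> = lin_ext scale \<phi> t + lin_ext scale \<phi> u"
    using lin_ext_superset[of ?S t] lin_ext_superset[of ?S u]
    by (simp add: lookup_add scale_left_distrib sum.distrib)
  finally show ?thesis .
qed

lemma lin_ext_tscale: "lin_ext scale \<phi> (tscale c t) = scale c (lin_ext scale \<phi> t)"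
proof -
  have "lin_ext scale \<phi> (tscale c t) =
      (\<Sum>w\<in>Poly_Mapping.keys t. scale (Poly_Mapping.lookup (tscale c t) w) (\<phi> w))"
    by (intro lin_ext_superset) (auto simp: in_keys_iff lookup_tscale)
  then show ?thesis
    by (simp add: lin_ext_def lookup_tscale scale_sum_right)
qed

lemma lin_ext_zero [simp]: "lin_ext scale \<phi> 0 = 0"
  by (simp add: lin_ext_def)

lemma lin_ext_diff: "lin_ext scale \<phi> (t - u) = lin_ext scale \<phi> t - lin_ext scale \<phi> u"
  using lin_ext_add[of \<phi> "t - u" u] by (simp add: algebra_simps)

lemma lin_ext_sum: "lin_ext scale \<phi> (\<Sum>i\<in>I. t i) = (\<Sum>i\<in>I. lin_ext scale \<phi> (t i))"
  by (induction I rule: infinite_finite_induct) (auto simp: lin_ext_add)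

lemma lin_ext_single: "lin_ext scale \<phi> (Poly_Mapping.single w a) = scale a (\<phi> w)"
  using lin_ext_superset[of "{w}" "Poly_Mapping.single w a" \<phi>] by simp

text \<open>Lets a composite such as \<open>Q Q\<close> be evaluated by applying the outer map to
  each word of the inner result.\<close>

lemma lin_ext_lin_ext:
  "lin_ext scale \<phi> (lin_ext tscale \<psi> t) = lin_ext scale (\<lambda>w. lin_ext scale \<phi> (\<psi> w)) t"
  by (simp add: lin_ext_def[of tscale] lin_ext_sum lin_ext_tscale)
     (simp add: lin_ext_def)

end

section \<open>The linear part of identities in the symmetric coalgebra\<close>

text \<open>The projection of the reduced symmetric coalgebra to its cogenerators. Composed with it,
  an identity of coderivations or coalgebra morphisms becomes an identity of multilinear
  maps.\<close>

definition word_proj :: "'v::zero word \<Rightarrow> 'v" where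
  "word_proj w = (if length w = 1 then snd (hd w) else 0)"

lemma koszul_sign_id: "koszul_sign ws id = 1"
  unfolding koszul_sign_def by (rule prod.neutral) auto

text \<open>No relation mixes lengths. On words of length one, the first kind is linearity of the
  identity and the second kind is trivial.\<close>

lemma word_proj_sym_relations:
  assumes "vector_space s" "t \<in> sym_relations s V"
  shows "lin_ext s word_proj t = 0"
proof -
  interpret vector_space s by fact
  consider (lin) xs ys d x y a b where "t = Poly_Mapping.single (xs @ (d, s a x + s b y) # ys) 1
        - Poly_Mapping.single (xs @ (d, x) # ys) a - Poly_Mapping.single (xs @ (d, y) # ys) b"
    | (sym) ws \<sigma> where "t = Poly_Mapping.single ws 1
        - Poly_Mapping.single (permute_list \<sigma> ws) (koszul_sign ws \<sigma>)"
        "\<sigma> permutes {..<length ws}"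
    using assms(2) unfolding sym_relations_def by blast
  then show ?thesis
  proof cases
    case lin
    then show ?thesis
      by (auto simp: lin_ext_diff lin_ext_single word_proj_def)
  next
    case sym
    \<comment> \<open>A single position admits no other permutation, and the sign of the identity is
      1.\<close>
    have "\<sigma> = id" if "length ws = 1"
      using sym(2) that by (simp add: lessThan_Suc)
    then show ?thesis
      using sym(1) by (cases "length ws = 1")
        (auto simp: lin_ext_diff lin_ext_single word_proj_def koszul_sign_id)
  qed
qed

text \<open>The kernel of the extended projection is a subspace containing all relations, hence
  their span. Thus a congruence of tensors yields an honest equation in the underlying
  space.\<close>

lemma sym_eq_word_proj:
  assumes "vector_space s" "sym_eq s V t u"
  shows "lin_ext s word_proj t = lin_ext s word_proj u"
proof -
  interpret vector_space s by fact
  interpret T: module "tscale :: 'a \<Rightarrow> ('b, 'a) tensor \<Rightarrow> ('b, 'a) tensor"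
    by (rule module_tscale)
  have "T.subspace {t. lin_ext s word_proj t = 0}"
    by (auto simp: T.subspace_def lin_ext_add lin_ext_tscale)
  moreover have "sym_relations s V \<subseteq> {t. lin_ext s word_proj t = 0}"
    using word_proj_sym_relations[OF assms(1)] by blast
  ultimately have "T.span (sym_relations s V) \<subseteq> {t. lin_ext s word_proj t = 0}"
    by (rule T.span_minimal[rotated])
  then have "lin_ext s word_proj (t - u) = 0"
    using assms(2) unfolding sym_eq_def by blast
  then show ?thesis
    by (simp add: lin_ext_diff)
qed

lemma length_blocks: "length (blocks is ws) = length is"
  by (induction "is" ws rule: blocks.induct) auto

context vector_space
begin

text \<open>Applying the i-th bracket to \<open>n\<close> letters leaves \<open>n - i + 1\<close>
  letters. Only \<open>i = n\<close> leaves one, and then the identity is the only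
  unshuffle.\<close>

lemma word_proj_coder:
  assumes "ws \<noteq> []"
  shows "lin_ext scale word_proj (coder q ws) = q (map snd ws)"
proof -
  have eq: "lin_ext scale word_proj (coder_part q i ws) = (if i = length ws then q (map snd ws) else 0)"
    if "i \<in> {1..length ws}" for i
  proof (cases "i = length ws")
    case True
    then show ?thesis
      by (simp add: coder_part_def unshuffles_pair_zero lin_ext_single word_proj_def koszul_sign_id)
  next
    case False
    then show ?thesis
      using that
      by (simp add: coder_part_def lin_ext_sum lin_ext_single word_proj_def Let_def)
  qed
  have "lin_ext scale word_proj (coder q ws) =
      (\<Sum>i=1..length ws. if i = length ws then q (map snd ws) else 0)"
    unfolding coder_def lin_ext_sum by (intro sum.cong refl eq)
  then show ?thesis
    using assms by (simp add: Suc_le_eq)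
qed

end

definition compositions :: "nat \<Rightarrow> nat \<Rightarrow> nat list set" where
  "compositions k n = {is. length is = k \<and> sum_list is = n \<and> (\<forall>i\<in>set is. 1 \<le> i)}"

lemma finite_compositions: "finite (compositions k n)"
proof (rule finite_subset)
  show "compositions k n \<subseteq> {is. set is \<subseteq> {..n} \<and> length is = k}"
    using member_le_sum_list by (fastforce simp: compositions_def)
qed (simp add: finite_lists_length_eq)

lemma mor_comp_compositions:
  "mor_comp f k ws = (\<Sum>is\<in>compositions k (length ws). \<Sum>\<sigma>\<in>unshuffles is.
     Poly_Mapping.single (map (\<lambda>b. (deg b, f (map snd b))) (blocks is (permute_list \<sigma> ws)))
       (koszul_sign ws \<sigma> / fact k))"
  by (simp add: mor_comp_def compositions_def)

lemma compositions_one: "n > 0 \<Longrightarrow> compositions 1 n = {[n]}"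
  by (auto simp: compositions_def length_Suc_conv)

text \<open>The k-th component consists of words with \<open>k\<close> letters, so only
  \<open>k = 1\<close> survives, with one block and the identity as its only unshuffle.\<close>

lemma word_proj_mor:
  fixes s :: "'k::field_char_0 \<Rightarrow> 'v::ab_group_add \<Rightarrow> 'v"
  assumes "vector_space s" "ws \<noteq> []"
  shows "lin_ext s word_proj (mor f ws) = f (map snd ws)"
proof -
  interpret vector_space s by fact
  have eq: "lin_ext s word_proj (mor_comp f k ws) = (if k = 1 then f (map snd ws) else 0)" for k
  proof (cases "k = 1")
    case True
    then show ?thesis
      using assms(2) compositions_one[of "length ws"]
      by (simp add: mor_comp_compositions unshuffles_singleton lin_ext_single word_proj_def
          koszul_sign_id)
  next
    case False
    then show ?thesis
      by (simp add: mor_comp_compositions lin_ext_sum lin_ext_single word_proj_def length_blocks)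
         (auto intro!: sum.neutral simp: compositions_def)
  qed
  have "lin_ext s word_proj (mor f ws) = (\<Sum>k=1..length ws. if k = 1 then f (map snd ws) else 0)"
    unfolding mor_def lin_ext_sum by (intro sum.cong refl eq)
  then show ?thesis
    using assms(2) by (simp add: Suc_le_eq)
qed

section \<open>Coderivations and coalgebra morphisms on powers of a degree 0 element\<close>

lemma koszul_sign_replicate_even:
  assumes "even d" "\<sigma> permutes {..<n}"
  shows "koszul_sign (replicate n (d, x)) \<sigma> = 1"
  unfolding koszul_sign_def
proof (rule prod.neutral, clarify)
  fix i j assume "i < j" "j < length (replicate n (d, x))"
  then have "\<sigma> i < n"
    using permutes_in_image[OF assms(2), of i] by simp
  then show "(if odd (fst (replicate n (d, x) ! \<sigma> i)) \<and> odd (fst (replicate n (d, x) ! \<sigma> j))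
      then - 1 else 1) = 1"
    using assms(1) by simp
qed

lemma permute_list_replicate: "\<sigma> permutes {..<n} \<Longrightarrow> permute_list \<sigma> (replicate n a) = replicate n a"
  by (rule nth_equalityI) (auto simp: permute_list_nth permutes_in_image[of _ "{..<n}", simplified])

lemma deg_replicate_zero [simp]: "deg (replicate n (0, x)) = 0"
  by (simp add: deg_def sum_list_replicate)

lemma blocks_replicate: "blocks is (replicate (sum_list is) a) = map (\<lambda>i. replicate i a) is"
  by (induction "is") auto

text \<open>Permuting equal letters of degree 0 changes neither the word nor the sign, so all
  unshuffles give the same summand. Their number is the binomial coefficient in front.\<close>

lemma lin_ext_coder_part_replicate:
  fixes s :: "'k::field_char_0 \<Rightarrow> 'v::ab_group_add \<Rightarrow> 'v"
  assumes "vector_space s" "i \<le> n"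
  shows "lin_ext s \<phi> (coder_part q i (replicate n (0, x))) =
    s (fact n / (fact i * fact (n - i)))
      (\<phi> ((1, q (replicate i x)) # replicate (n - i) (0, x)))"
proof -
  interpret vector_space s by fact
  have "lin_ext s \<phi> (coder_part q i (replicate n (0, x))) =
      (\<Sum>\<sigma>\<in>unshuffles [i, n - i]. \<phi> ((1, q (replicate i x)) # replicate (n - i) (0, x)))"
    unfolding coder_part_def lin_ext_sum length_replicate
  proof (rule sum.cong[OF refl])
    fix \<sigma> assume "\<sigma> \<in> unshuffles [i, n - i]"
    then have \<sigma>: "\<sigma> permutes {..<n}"
      using assms(2) unshuffles_permutes by fastforce
    show "lin_ext s \<phi> (let us = permute_list \<sigma> (replicate n (0, x)) in
        Poly_Mapping.single ((deg (take i us) + 1, q (map snd (take i us))) # drop i us)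
          (koszul_sign (replicate n (0, x)) \<sigma>)) =
        \<phi> ((1, q (replicate i x)) # replicate (n - i) (0, x))"
      using assms(2)
      by (simp add: permute_list_replicate[OF \<sigma>] koszul_sign_replicate_even[OF _ \<sigma>] lin_ext_single
          min_absorb1)
  qed
  also have "\<dots> = s (of_nat (card (unshuffles [i, n - i])))
      (\<phi> ((1, q (replicate i x)) # replicate (n - i) (0, x)))"
    by (simp add: sum_constant_scale)
  finally show ?thesis
    using assms(2) by (simp add: of_nat_card_unshuffles)
qed

lemma lin_ext_coder_replicate:
  fixes s :: "'k::field_char_0 \<Rightarrow> 'v::ab_group_add \<Rightarrow> 'v"
  assumes "vector_space s"
  shows "lin_ext s \<phi> (coder q (replicate n (0, x))) =
    (\<Sum>i=1..n. s (fact n / (fact i * fact (n - i)))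
      (\<phi> ((1, q (replicate i x)) # replicate (n - i) (0, x))))"
proof -
  interpret vector_space s by fact
  show ?thesis
    unfolding coder_def lin_ext_sum length_replicate
    by (intro sum.cong refl lin_ext_coder_part_replicate assms) auto
qed

text \<open>As for coderivations, the summand depends only on the block lengths, and counting the
  unshuffles of each composition gives a multinomial coefficient.\<close>

lemma lin_ext_mor_comp_replicate:
  fixes s :: "'k::field_char_0 \<Rightarrow> 'v::ab_group_add \<Rightarrow> 'v"
  assumes "vector_space s"
  shows "lin_ext s \<phi> (mor_comp f k (replicate n (0, x))) =
    (\<Sum>is\<in>compositions k n. s (fact n / (\<Prod>i\<leftarrow>is. fact i) / fact k)
      (\<phi> (map (\<lambda>i. (0, f (replicate i x))) is)))"
proof -
  interpret vector_space s by fact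
  have "lin_ext s \<phi> (\<Sum>\<sigma>\<in>unshuffles is.
      Poly_Mapping.single
        (map (\<lambda>b. (deg b, f (map snd b))) (blocks is (permute_list \<sigma> (replicate n (0, x)))))
        (koszul_sign (replicate n (0, x)) \<sigma> / fact k)) =
      s (fact n / (\<Prod>i\<leftarrow>is. fact i) / fact k) (\<phi> (map (\<lambda>i. (0, f (replicate i x))) is))"
    if "is \<in> compositions k n" for "is"
  proof -
    have n: "sum_list is = n"
      using that by (simp add: compositions_def)
    have "lin_ext s \<phi> (\<Sum>\<sigma>\<in>unshuffles is.
        Poly_Mapping.single
          (map (\<lambda>b. (deg b, f (map snd b))) (blocks is (permute_list \<sigma> (replicate n (0, x)))))
          (koszul_sign (replicate n (0, x)) \<sigma> / fact k)) =
        (\<Sum>\<sigma>\<in>unshuffles is. s (1 / fact k) (\<phi> (map (\<lambda>i. (0, f (replicate i x))) is)))"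
      unfolding lin_ext_sum
    proof (rule sum.cong[OF refl])
      fix \<sigma> assume "\<sigma> \<in> unshuffles is"
      then have \<sigma>: "\<sigma> permutes {..<n}"
        using unshuffles_permutes n by fastforce
      show "lin_ext s \<phi> (Poly_Mapping.single
          (map (\<lambda>b. (deg b, f (map snd b))) (blocks is (permute_list \<sigma> (replicate n (0, x)))))
          (koszul_sign (replicate n (0, x)) \<sigma> / fact k)) =
          s (1 / fact k) (\<phi> (map (\<lambda>i. (0, f (replicate i x))) is))"
        using blocks_replicate[of "is" "(0 :: int, x)"]
        by (simp add: permute_list_replicate[OF \<sigma>] koszul_sign_replicate_even[OF _ \<sigma>]
            lin_ext_single n o_def)
    qed
    also have "\<dots> = s (of_nat (card (unshuffles is)) * (1 / fact k))
        (\<phi> (map (\<lambda>i. (0, f (replicate i x))) is))"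
      by (simp add: sum_constant_scale)
    finally show ?thesis
      by (simp add: of_nat_card_unshuffles n)
  qed
  then show ?thesis
    unfolding mor_comp_compositions lin_ext_sum length_replicate by (intro sum.cong refl) simp
qed

section \<open>Graded linear maps\<close>

lemma graded_linear_add_diff:
  assumes "graded_linear sV V sW W e m" "vector_space sV" "vector_space sW"
    and "x \<in> V k" "y \<in> V k"
  shows "m (x + y) = m x + m y" "m (x - y) = m x - m y"
proof -
  interpret S: vector_space sV by fact
  interpret T: vector_space sW by fact
  have "m (sV a x + sV b y) = sW a (m x) + sW b (m y)" for a b
    using assms unfolding graded_linear_def by blast
  from this[of 1 1] this[of 1 "- 1"]
  show "m (x + y) = m x + m y" "m (x - y) = m x - m y"
    by simp_all
qed

lemma graded_linear_scale:
  assumes "graded_linear sV V sW W e m" "vector_space sV" "vector_space sW" "x \<in> V k"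
  shows "m (sV a x) = sW a (m x)"
proof -
  interpret S: vector_space sV by fact
  interpret T: vector_space sW by fact
  have "m (sV a x + sV 0 x) = sW a (m x) + sW 0 (m x)"
    using assms unfolding graded_linear_def by blast
  then show ?thesis
    by simp
qed

lemma graded_linear_sum:
  assumes "graded_linear sV V sW W e m" "vector_space sV" "vector_space sW"
    and "module.subspace sV (V k)" "\<And>i. i \<in> I \<Longrightarrow> t i \<in> V k"
  shows "m (\<Sum>i\<in>I. t i) = (\<Sum>i\<in>I. m (t i))"
proof -
  interpret S: vector_space sV by fact
  have 0: "m 0 = 0"
    using graded_linear_add_diff(2)[OF assms(1-3), of 0 k 0] S.subspace_0[OF assms(4)] by simp
  show ?thesis
    using assms(5)
  proof (induction I rule: infinite_finite_induct)
    case (insert i I)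
    then have "(\<Sum>i\<in>I. t i) \<in> V k"
      by (intro S.subspace_sum assms(4)) auto
    then show ?case
      using insert graded_linear_add_diff(1)[OF assms(1-3), of "t i" k] by simp
  qed (simp_all add: 0)
qed

section \<open>Complete filtered spaces\<close>

locale complete_space = vector_space s
  for s :: "'k::field_char_0 \<Rightarrow> 'v::ab_group_add \<Rightarrow> 'v" +
  fixes V :: "int \<Rightarrow> 'v set" and F :: "nat \<Rightarrow> int \<Rightarrow> 'v set"
  assumes complete: "complete_filtration s V F"
begin

lemma filtration_one: "F 1 = V"
  using complete by (simp add: complete_filtration_def)

lemma subspace_filtration: "1 \<le> p \<Longrightarrow> subspace (F p k)"
  using complete by (simp add: complete_filtration_def)

lemma subspace_component: "subspace (V k)"
  using subspace_filtration[of 1 k] filtration_one by simp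

lemma filtration_antimono:
  assumes "1 \<le> p" "p \<le> p'"
  shows "F p' k \<subseteq> F p k"
  using assms(2)
proof (induction rule: dec_induct)
  case (step n)
  have "F (Suc n) k \<subseteq> F n k"
    using complete step.hyps(1) assms(1) by (simp add: complete_filtration_def)
  then show ?case
    using step.IH by blast
qed simp

lemma filtration_mono_mem: "x \<in> F p' k \<Longrightarrow> 1 \<le> p \<Longrightarrow> p \<le> p' \<Longrightarrow> x \<in> F p k"
  using filtration_antimono by blast

lemma filtration_subset: "1 \<le> p \<Longrightarrow> F p k \<subseteq> V k"
  using filtration_antimono[of 1 p k] filtration_one by simp

lemma zero_mem [simp]: "1 \<le> p \<Longrightarrow> 0 \<in> F p k" and zero_mem_component [simp]: "0 \<in> V k"
  by (simp_all add: subspace_0 subspace_filtration subspace_component)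

text \<open>The uniqueness half of completeness for the constant sequence 0: both \<open>x\<close>
  and 0 are limits of it.\<close>

lemma eq_zero_if_mem_filtration:
  assumes "\<And>p. 1 \<le> p \<Longrightarrow> x \<in> F p k"
  shows "x = 0"
proof -
  have "\<exists>!y. y \<in> V k \<and> (\<forall>p\<ge>1. y - 0 \<in> F p k)"
    using complete unfolding complete_filtration_def
    by (elim conjE allE[of _ k] allE[of _ "\<lambda>_. 0"]) simp
  then obtain z where z: "\<And>y. y \<in> V k \<Longrightarrow> \<forall>p\<ge>1. y \<in> F p k \<Longrightarrow> y = z"
    by auto
  have "x \<in> V k"
    using assms[of 1] filtration_one by simp
  then show ?thesis
    using z[of x] z[of 0] assms by simp
qed

lemma eq_if_diff_mem_filtration: "(\<And>p. 1 \<le> p \<Longrightarrow> x - y \<in> F p k) \<Longrightarrow> x = y"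
  using eq_zero_if_mem_filtration[of "x - y" k] by simp

lemma filt_tendsto_unique:
  assumes "filt_tendsto F k X x" "filt_tendsto F k X y"
  shows "x = y"
proof (rule eq_if_diff_mem_filtration)
  fix p :: nat assume p: "1 \<le> p"
  have "\<forall>\<^sub>F n in sequentially. X n - x \<in> F p k \<and> X n - y \<in> F p k"
    using assms p by (auto simp: filt_tendsto_def intro: eventually_conj)
  then obtain n where "X n - x \<in> F p k" "X n - y \<in> F p k"
    by (auto simp: eventually_sequentially)
  then have "(X n - y) - (X n - x) \<in> F p k"
    using subspace_diff[OF subspace_filtration[OF p]] by blast
  then show "x - y \<in> F p k"
    by simp
qed

lemma filt_tendstoI:
  assumes "\<And>n. x - X n \<in> F (Suc n) k"
  shows "filt_tendsto F k X x"
  unfolding filt_tendsto_def eventually_sequentially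
proof (intro allI impI exI)
  fix p n :: nat assume p: "1 \<le> p" "p \<le> n"
  have "- (x - X n) \<in> F (Suc n) k"
    using assms by (intro subspace_neg subspace_filtration) auto
  then show "X n - x \<in> F p k"
    using filtration_mono_mem[of _ "Suc n" k p] p by simp
qed

lemma complete_seq:
  assumes "\<And>n. 1 \<le> n \<Longrightarrow> X n \<in> V k" "\<And>n. 1 \<le> n \<Longrightarrow> X (Suc n) - X n \<in> F n k"
  obtains x where "x \<in> V k" "\<And>n. 1 \<le> n \<Longrightarrow> x - X n \<in> F n k"
  using complete assms unfolding complete_filtration_def
  by (elim conjE allE[of _ k] allE[of _ X]) blast

text \<open>Banach's argument for the filtration. \<open>X n\<close> and \<open>X (Suc n)\<close>
  agree modulo \<open>F (Suc n)\<close>: at the start because \<open>F 1\<close> is everything,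
  later because each application of \<open>T\<close> gains a step. Completeness yields a limit
  \<open>x\<close>, and \<open>x\<close> and \<open>T x\<close> are both congruent to
  \<open>X (Suc p)\<close> modulo \<open>F p\<close> for every \<open>p\<close>.\<close>

lemma contraction_fixed_point:
  assumes T: "\<And>x. x \<in> V k \<Longrightarrow> T x \<in> V k"
    and contr: "\<And>p x y. 1 \<le> p \<Longrightarrow> x \<in> V k \<Longrightarrow> y \<in> V k \<Longrightarrow> x - y \<in> F p k \<Longrightarrow>
                  T x - T y \<in> F (Suc p) k"
    and X: "X 0 \<in> V k" "\<And>n. X (Suc n) = T (X n)"
  obtains x where "x \<in> V k" "T x = x" "filt_tendsto F k X x"
proof -
  have XV: "X n \<in> V k" for n
    using X T by (induction n) auto
  have step: "X (Suc n) - X n \<in> F (Suc n) k" for n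
  proof (induction n)
    case 0
    then show ?case
      using subspace_diff[OF subspace_component XV XV] filtration_one by simp
  next
    case (Suc n)
    show ?case
      using contr[OF _ XV XV Suc.IH] X(2) by simp
  qed
  obtain x where x: "x \<in> V k" "\<And>n. 1 \<le> n \<Longrightarrow> x - X n \<in> F n k"
    using complete_seq[of X k] XV filtration_mono_mem[OF step] by (metis le_SucI order_refl)
  have fixed: "T x = x"
  proof (rule eq_if_diff_mem_filtration)
    fix p :: nat assume p: "1 \<le> p"
    have "T x - X (Suc p) \<in> F p k"
      using contr[OF p x(1) XV x(2)[OF p]] X(2) p filtration_mono_mem by simp
    moreover have "x - X (Suc p) \<in> F p k"
      using x(2)[of "Suc p"] p filtration_mono_mem by simp
    ultimately have "(T x - X (Suc p)) - (x - X (Suc p)) \<in> F p k"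
      by (rule subspace_diff[OF subspace_filtration[OF p]])
    then show "T x - x \<in> F p k"
      by simp
  qed
  have "filt_tendsto F k X x"
    unfolding filt_tendsto_def eventually_sequentially
  proof (intro allI impI exI)
    fix p n :: nat assume p: "1 \<le> p" "p \<le> n"
    then have "- (x - X n) \<in> F n k"
      using x(2) by (intro subspace_neg subspace_filtration) auto
    then show "X n - x \<in> F p k"
      using filtration_mono_mem[of _ n k p] p by simp
  qed
  then show ?thesis
    using that x(1) fixed by blast
qed

text \<open>The difference of two fixed points lies in \<open>F 1\<close>, and applying
  \<open>T\<close> to both moves it from \<open>F p\<close> to \<open>F (Suc p)\<close>.\<close>

lemma contraction_fixed_point_unique:
  assumes contr: "\<And>p x y. 1 \<le> p \<Longrightarrow> x \<in> V k \<Longrightarrow> y \<in> V k \<Longrightarrow> x - y \<in> F p k \<Longrightarrow>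
                  T x - T y \<in> F (Suc p) k"
    and x: "x \<in> V k" "T x = x" and y: "y \<in> V k" "T y = y"
  shows "x = y"
proof (rule eq_if_diff_mem_filtration)
  fix p :: nat assume "1 \<le> p"
  then show "x - y \<in> F p k"
  proof (induction p rule: nat_induct_at_least)
    case base
    then show ?case
      using subspace_diff[OF subspace_component x(1) y(1)] filtration_one by simp
  next
    case (Suc p)
    then show ?case
      using contr[of p x y] x y by simp
  qed
qed

section \<open>Series whose i-th term lies in the i-th step of the filtration\<close>

lemma filt_sum_eqI:
  assumes "x \<in> V k" "\<And>N. x - (\<Sum>i=m..N. t i) \<in> F (Suc N) k"
  shows "filt_sum F k m t = x"
  unfolding filt_sum_def
proof (rule the_equality)
  show *: "x \<in> F 1 k \<and> filt_tendsto F k (\<lambda>n. \<Sum>i=m..n. t i) x"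
    using assms filt_tendstoI filtration_one by simp
  show "y = x" if "y \<in> F 1 k \<and> filt_tendsto F k (\<lambda>n. \<Sum>i=m..n. t i) y" for y
    using that * filt_tendsto_unique by blast
qed

lemma filt_sum_remainder:
  assumes "1 \<le> m" "\<And>i. m \<le> i \<Longrightarrow> t i \<in> F i k"
  shows "filt_sum F k m t \<in> F m k"
    and "filt_sum F k m t - (\<Sum>i=m..N. t i) \<in> F (Suc N) k"
proof -
  \<comment> \<open>With the upper bound excluded, passing from \<open>n\<close> to
    \<open>Suc n\<close> adds \<open>t n\<close>, an element of \<open>F n\<close>, which is the
    increment that the definition of completeness asks for.\<close>
  let ?c = "\<lambda>n. \<Sum>i=m..<n. t i"
  have tV: "t i \<in> V k" if "m \<le> i" for i
    using assms that filtration_subset[of i k] by fastforce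
  have "?c n \<in> V k" for n
    using tV by (intro subspace_sum subspace_component) auto
  moreover have "?c (Suc n) - ?c n \<in> F n k" if "1 \<le> n" for n
    using assms(2) that by (cases "m \<le> n") auto
  ultimately obtain x where x: "x \<in> V k" "\<And>n. 1 \<le> n \<Longrightarrow> x - ?c n \<in> F n k"
    using complete_seq[of ?c k] by blast
  have eq: "filt_sum F k m t = x"
    using x(2)[of "Suc _"] by (intro filt_sum_eqI x(1)) (simp add: atLeastLessThanSuc_atLeastAtMost)
  \<comment> \<open>At index \<open>m\<close> the partial sum is empty, so the remainder is the
    whole series.\<close>
  show "filt_sum F k m t \<in> F m k"
    using x(2)[OF assms(1)] eq by simp
  show "filt_sum F k m t - (\<Sum>i=m..N. t i) \<in> F (Suc N) k"
    using x(2)[of "Suc N"] eq by (simp add: atLeastLessThanSuc_atLeastAtMost)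
qed

lemma filt_sum_mem:
  assumes "1 \<le> m" "\<And>i. m \<le> i \<Longrightarrow> t i \<in> F i k"
  shows "filt_sum F k m t \<in> V k"
  using filt_sum_remainder(1)[OF assms] filtration_subset[OF assms(1)] by blast

lemma filt_sum_tendsto:
  assumes "1 \<le> m" "\<And>i. m \<le> i \<Longrightarrow> t i \<in> F i k"
  shows "filt_tendsto F k (\<lambda>n. \<Sum>i=m..n. t i) (filt_sum F k m t)"
  by (intro filt_tendstoI filt_sum_remainder assms)

text \<open>Cut both series at \<open>p\<close>. The tails lie in \<open>F p\<close> anyway, and the
  finite parts are compared term by term.\<close>

lemma filt_sum_diff_mem:
  assumes "1 \<le> m" "\<And>i. m \<le> i \<Longrightarrow> t i \<in> F i k" "\<And>i. m \<le> i \<Longrightarrow> t' i \<in> F i k"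
    and p: "1 \<le> p" "\<And>i. m \<le> i \<Longrightarrow> t i - t' i \<in> F p k"
  shows "filt_sum F k m t - filt_sum F k m t' \<in> F p k"
proof -
  have "filt_sum F k m t - (\<Sum>i=m..p. t i) \<in> F p k" "filt_sum F k m t' - (\<Sum>i=m..p. t' i) \<in> F p k"
    using filt_sum_remainder(2)[of m _ k p] assms(1-4) by (auto intro!: filtration_mono_mem[of _ "Suc p" k p])
  moreover have "(\<Sum>i=m..p. t i - t' i) \<in> F p k"
    using p by (intro subspace_sum subspace_filtration) auto
  ultimately have "(filt_sum F k m t - (\<Sum>i=m..p. t i)) - (filt_sum F k m t' - (\<Sum>i=m..p. t' i))
      + (\<Sum>i=m..p. t i - t' i) \<in> F p k"
    by (rule subspace_add[OF subspace_filtration[OF p(1)] subspace_diff[OF subspace_filtration[OF p(1)]]])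
  then show ?thesis
    by (simp add: sum_subtractf algebra_simps)
qed

lemma filt_sum_split_first:
  assumes "\<And>i. 1 \<le> i \<Longrightarrow> t i \<in> F i k"
  shows "filt_sum F k 1 t = t 1 + filt_sum F k 2 t"
proof (rule filt_sum_eqI)
  have mem: "t i \<in> F i k" if "2 \<le> i" for i
    using assms that by simp
  have t1: "t 1 \<in> V k"
    using assms[of 1] filtration_one by simp
  show V: "t 1 + filt_sum F k 2 t \<in> V k"
    using filt_sum_mem[OF _ mem] t1 by (intro subspace_add subspace_component) auto
  show "t 1 + filt_sum F k 2 t - (\<Sum>i=1..N. t i) \<in> F (Suc N) k" for N
  proof (cases N)
    case 0
    then show ?thesis
      using V filtration_one by simp
  next
    case (Suc M)
    then have "(\<Sum>i=1..N. t i) = t 1 + (\<Sum>i=2..N. t i)"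
      by (simp add: sum.atLeast_Suc_atMost numeral_2_eq_2)
    then show ?thesis
      using filt_sum_remainder(2)[of 2 t k N] mem by simp
  qed
qed

lemma filt_sum_zero: "(\<And>i. m \<le> i \<Longrightarrow> t i = 0) \<Longrightarrow> filt_sum F k m t = 0"
  by (rule filt_sum_eqI) simp_all

lemma filt_sum_minus:
  assumes "1 \<le> m" "\<And>i. m \<le> i \<Longrightarrow> t i \<in> F i k" "\<And>i. m \<le> i \<Longrightarrow> u i \<in> F i k"
  shows "filt_sum F k m (\<lambda>i. t i - u i) = filt_sum F k m t - filt_sum F k m u"
proof (rule filt_sum_eqI)
  show "filt_sum F k m t - filt_sum F k m u \<in> V k"
    by (intro subspace_diff subspace_component filt_sum_mem assms)
  fix N
  have "(filt_sum F k m t - (\<Sum>i=m..N. t i)) - (filt_sum F k m u - (\<Sum>i=m..N. u i)) \<in> F (Suc N) k"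
    using assms by (intro subspace_diff[OF subspace_filtration filt_sum_remainder(2) filt_sum_remainder(2)]) auto
  then show "filt_sum F k m t - filt_sum F k m u - (\<Sum>i=m..N. t i - u i) \<in> F (Suc N) k"
    by (simp add: sum_subtractf algebra_simps)
qed

end

text \<open>A filtered additive map sends remainders to remainders, hence commutes with the series.
  Additivity is asked for in one degree only because graded linear maps are controlled only on
  homogeneous components.\<close>

lemma (in complete_space) filt_sum_linear:
  assumes "1 \<le> m" "\<And>i. m \<le> i \<Longrightarrow> t i \<in> F i k" and T: "complete_space sW W F'"
    and add: "\<And>x y. x \<in> V k \<Longrightarrow> y \<in> V k \<Longrightarrow> \<phi> (x + y) = \<phi> x + \<phi> y"
    and filt: "\<And>p x. 1 \<le> p \<Longrightarrow> x \<in> F p k \<Longrightarrow> \<phi> x \<in> F' p k'"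
  shows "\<phi> (filt_sum F k m t) = filt_sum F' k' m (\<lambda>i. \<phi> (t i))"
proof -
  interpret T: complete_space sW W F' by fact
  have zero: "\<phi> 0 = 0"
    using add[of 0 0] by simp
  have sum: "\<phi> (\<Sum>i\<in>I. t i) = (\<Sum>i\<in>I. \<phi> (t i)) \<and> (\<Sum>i\<in>I. t i) \<in> V k" if "finite I" "\<And>i. i \<in> I \<Longrightarrow> t i \<in> V k" for I
    using that
    by (induction I) (auto simp: zero add intro!: subspace_add subspace_component)
  have tV: "t i \<in> V k" if "m \<le> i" for i
    using assms that filtration_subset[of i k] by fastforce
  have diff: "\<phi> (x - y) = \<phi> x - \<phi> y" if "x \<in> V k" "y \<in> V k" for x y
    using add[of "x - y" y] that subspace_diff[OF subspace_component] by (simp add: algebra_simps)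
  have s: "filt_sum F k m t \<in> V k"
    by (rule filt_sum_mem[OF assms(1,2)])
  show ?thesis
  proof (rule T.filt_sum_eqI[symmetric])
    show "\<phi> (filt_sum F k m t) \<in> W k'"
      using filt[of 1] s filtration_one T.filtration_one by simp
    show "\<phi> (filt_sum F k m t) - (\<Sum>i=m..N. \<phi> (t i)) \<in> F' (Suc N) k'" for N
      using sum[of "{m..N}"] tV diff s filt[OF _ filt_sum_remainder(2)[of m t k N, OF assms(1,2)]] by simp
  qed
qed

section \<open>Filtered multilinear maps\<close>

lemma words_Nil [simp]: "[] \<in> words V"
  and words_Cons [simp]: "(d, v) # ws \<in> words V \<longleftrightarrow> v \<in> V d \<and> ws \<in> words V"
  and words_append [simp]: "ws @ ws' \<in> words V \<longleftrightarrow> ws \<in> words V \<and> ws' \<in> words V"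
  by (auto simp: words_def)

lemma words_replicate [simp]: "x \<in> V d \<Longrightarrow> replicate n (d, x) \<in> words V"
  by (auto simp: words_def)

lemma deg_Nil [simp]: "deg [] = 0"
  and deg_Cons [simp]: "deg ((d, v) # ws) = d + deg ws"
  and deg_append [simp]: "deg (ws @ ws') = deg ws + deg ws'"
  by (simp_all add: deg_def)

text \<open>The common setting for the brackets (degree 1), the morphisms (degree 0) and the
  combination \<open>K q - f1 g\<close> that drives the iteration.\<close>

locale filtered_multilinear_map = S: complete_space sV V F + T: complete_space sW W F'
  for sV :: "'k::field_char_0 \<Rightarrow> 'v::ab_group_add \<Rightarrow> 'v" and V F
    and sW :: "'k \<Rightarrow> 'w::ab_group_add \<Rightarrow> 'w" and W F' +
  fixes e :: int and m :: "'v list \<Rightarrow> 'w"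
  assumes filtered: "filtered_family V F F' e m"
    and linear: "\<And>xs ys d a b x y. xs \<in> words V \<Longrightarrow> ys \<in> words V \<Longrightarrow> x \<in> V d \<Longrightarrow> y \<in> V d \<Longrightarrow>
        m (map snd xs @ (sV a x + sV b y) # map snd ys) =
        sW a (m (map snd xs @ x # map snd ys)) + sW b (m (map snd xs @ y # map snd ys))"
begin

text \<open>Since \<open>F 1\<close> is the whole space, each of the other letters has weight at
  least 1. Every additional letter therefore improves the filtration index by one.\<close>

lemma mem_filtration_letter:
  assumes "xs \<in> words V" "ys \<in> words V" "x \<in> F p d" "1 \<le> p"
  shows "m (map snd xs @ x # map snd ys) \<in> F' (length xs + p + length ys) (deg xs + d + deg ys + e)"
proof -
  let ?ws = "xs @ (d, x) # ys"
  let ?ps = "replicate (length xs) 1 @ p # replicate (length ys) 1"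
  have x: "x \<in> V d"
    using assms(3) S.filtration_subset[OF assms(4)] by blast
  have one: "snd (zs ! j) \<in> F 1 (fst (zs ! j))" if "zs \<in> words V" "j < length zs" for zs j
    using that S.filtration_one by (auto simp: words_def dest!: bspec[OF _ nth_mem])
  have "1 \<le> ?ps ! j \<and> snd (?ws ! j) \<in> F (?ps ! j) (fst (?ws ! j))" if "j < length ?ws" for j
  proof -
    consider "j < length xs" | "j = length xs" | i where "j = length xs + Suc i" "i < length ys"
    proof (cases "j \<le> length xs")
      case False
      then have "j = length xs + Suc (j - Suc (length xs))" "j - Suc (length xs) < length ys"
        using \<open>j < length ?ws\<close> by auto
      then show ?thesis
        using that(3) by blast
    qed (use that in fastforce)
    then show ?thesis
      using one[OF assms(1)] one[OF assms(2)] assms(3,4)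
      by cases (auto simp: nth_append)
  qed
  moreover have "?ws \<in> words V" "length ?ps = length ?ws" "?ws \<noteq> []"
    using assms x by auto
  ultimately have "m (map snd ?ws) \<in> F' (sum_list ?ps) (deg ?ws + e)"
    using filtered unfolding filtered_family_def by blast
  then show ?thesis
    by (simp add: sum_list_replicate add.assoc)
qed

lemma mem_filtration_length:
  assumes "ws \<in> words V" "ws \<noteq> []"
  shows "m (map snd ws) \<in> F' (length ws) (deg ws + e)"
proof -
  obtain d x ys where ws: "ws = (d, x) # ys"
    using assms(2) by (cases ws) auto
  then show ?thesis
    using mem_filtration_letter[of "[]" ys x 1 d] assms S.filtration_one by simp
qed

lemma mem_component:
  assumes "ws \<in> words V" "ws \<noteq> []"
  shows "m (map snd ws) \<in> W (deg ws + e)"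
proof -
  have "1 \<le> length ws"
    using assms(2) by (simp add: Suc_le_eq)
  then show ?thesis
    using mem_filtration_length[OF assms] T.filtration_subset by blast
qed

lemma replicate_mem_filtration: "x \<in> V 0 \<Longrightarrow> 1 \<le> i \<Longrightarrow> m (replicate i x) \<in> F' i e"
  using mem_filtration_length[of "replicate i (0, x)"] by auto

lemma mem_filtration_map:
  assumes "is \<noteq> []" "\<And>i. i \<in> set is \<Longrightarrow> 1 \<le> i" "\<And>i. i \<in> set is \<Longrightarrow> t i \<in> F i 0"
  shows "m (map t is) \<in> F' (sum_list is) e"
proof -
  let ?ws = "map (\<lambda>i. (0 :: int, t i)) is"
  have "?ws \<in> words V"
    using assms S.filtration_subset by (fastforce simp: words_def)
  moreover have "\<forall>j<length ?ws. 1 \<le> is ! j \<and> snd (?ws ! j) \<in> F (is ! j) (fst (?ws ! j))"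
    using assms by simp
  moreover have "length is = length ?ws" "?ws \<noteq> []"
    using assms(1) by auto
  ultimately have "m (map snd ?ws) \<in> F' (sum_list is) (deg ?ws + e)"
    by (intro filtered[unfolded filtered_family_def, THEN bspec, THEN spec, THEN mp] conjI)
  then show ?thesis
    by (simp add: deg_def o_def)
qed

lemma add_letter:
  assumes "xs \<in> words V" "ys \<in> words V" "x \<in> V d" "y \<in> V d"
  shows "m (map snd xs @ (x + y) # map snd ys) = m (map snd xs @ x # map snd ys) + m (map snd xs @ y # map snd ys)"
  using linear[OF assms, of 1 1] by simp

lemma scale_letter:
  assumes "xs \<in> words V" "ys \<in> words V" "x \<in> V d"
  shows "m (map snd xs @ sV a x # map snd ys) = sW a (m (map snd xs @ x # map snd ys))"
  using linear[OF assms assms(3), of a 0] by simp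

lemma zero_letter:
  assumes "xs \<in> words V" "ys \<in> words V"
  shows "m (map snd xs @ 0 # map snd ys) = 0"
  using scale_letter[OF assms, of 0 0 0] by simp

lemma diff_letter:
  assumes "xs \<in> words V" "ys \<in> words V" "x \<in> V d" "y \<in> V d"
  shows "m (map snd xs @ (x - y) # map snd ys) = m (map snd xs @ x # map snd ys) - m (map snd xs @ y # map snd ys)"
  using linear[OF assms, of 1 "- 1"] by simp

lemma sum_letter:
  assumes "xs \<in> words V" "ys \<in> words V" "\<And>i. i \<in> I \<Longrightarrow> t i \<in> V d"
  shows "m (map snd xs @ (\<Sum>i\<in>I. t i) # map snd ys) = (\<Sum>i\<in>I. m (map snd xs @ t i # map snd ys))"
  using assms(3)
proof (induction I rule: infinite_finite_induct)
  case (insert i I)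
  then have "(\<Sum>i\<in>I. t i) \<in> V d"
    by (intro S.subspace_sum S.subspace_component) auto
  then show ?case
    using insert assms by (simp add: add_letter[of xs ys _ d])
qed (simp_all add: zero_letter assms)

lemma eq_zero_if_zero_letter:
  assumes "ws \<in> words V" "(d, 0) \<in> set ws"
  shows "m (map snd ws) = 0"
proof -
  obtain xs ys where "ws = xs @ (d, 0) # ys"
    using assms(2) by (meson split_list)
  then show ?thesis
    using assms(1) zero_letter[of xs ys] by simp
qed

text \<open>The prefix \<open>xs\<close> collects the letters already treated, so that the induction
  can proceed from left to right.\<close>

lemma map_scale:
  assumes "xs \<in> words V" "\<And>i. i \<in> set is \<Longrightarrow> t i \<in> V 0"
  shows "m (map snd xs @ map (\<lambda>i. sV (c i) (t i)) is) = sW (\<Prod>i\<leftarrow>is. c i) (m (map snd xs @ map t is))"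
  using assms
proof (induction "is" arbitrary: xs)
  case (Cons i "is")
  let ?ys = "map (\<lambda>j. (0 :: int, sV (c j) (t j))) is"
  have ys: "?ys \<in> words V"
    using Cons.prems S.subspace_scale[OF S.subspace_component] by (auto simp: words_def)
  have "m (map snd xs @ sV (c i) (t i) # map snd ?ys) = sW (c i) (m (map snd xs @ t i # map snd ?ys))"
    using Cons.prems ys by (intro scale_letter) auto
  also have "\<dots> = sW (c i) (m (map snd (xs @ [(0, t i)]) @ map (\<lambda>j. sV (c j) (t j)) is))"
    by (simp add: o_def)
  also have "\<dots> = sW (c i) (sW (\<Prod>i\<leftarrow>is. c i) (m (map snd (xs @ [(0, t i)]) @ map t is)))"
    using Cons.prems by (subst Cons.IH) auto
  finally show ?case
    by (simp add: o_def)
qed simp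

text \<open>The expansion is indexed by ordered lists instead of multisets, which matches the
  indexing of coalgebra morphisms by compositions.\<close>

lemma replicate_sum:
  assumes "xs \<in> words V" "finite I" "\<And>i. i \<in> I \<Longrightarrow> t i \<in> V 0"
  shows "m (map snd xs @ replicate k (\<Sum>i\<in>I. t i)) =
    (\<Sum>is\<in>{is. set is \<subseteq> I \<and> length is = k}. m (map snd xs @ map t is))"
  using assms(1)
proof (induction k arbitrary: xs)
  case 0
  have "{is. set is \<subseteq> I \<and> length is = 0} = {[]}"
    by auto
  then show ?case
    by simp
next
  case (Suc k)
  let ?s = "\<Sum>i\<in>I. t i"
  let ?L = "\<lambda>k. {is. set is \<subseteq> I \<and> length is = k}"
  have s: "?s \<in> V 0"
    using assms(3) by (intro S.subspace_sum S.subspace_component) auto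
  have "m (map snd xs @ ?s # map snd (replicate k (0 :: int, ?s))) =
      (\<Sum>i\<in>I. m (map snd xs @ t i # map snd (replicate k (0 :: int, ?s))))"
    using Suc.prems assms(3) s by (intro sum_letter) auto
  also have "\<dots> = (\<Sum>i\<in>I. m (map snd (xs @ [(0, t i)]) @ replicate k ?s))"
    by simp
  also have "\<dots> = (\<Sum>i\<in>I. \<Sum>is\<in>?L k. m (map snd (xs @ [(0, t i)]) @ map t is))"
    using Suc.prems assms(3) by (intro sum.cong refl Suc.IH) auto
  also have "\<dots> = (\<Sum>is\<in>?L k. \<Sum>i\<in>I. m (map snd xs @ map t (i # is)))"
    by (subst sum.swap) simp
  also have "\<dots> = (\<Sum>(is, i)\<in>?L k \<times> I. m (map snd xs @ map t (i # is)))"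
    by (simp add: sum.cartesian_product)
  also have "\<dots> = (\<Sum>is\<in>?L (Suc k). m (map snd xs @ map t is))"
    unfolding lists_length_Suc_eq
    by (subst sum.reindex) (auto simp: inj_on_def intro!: sum.cong)
  finally show ?case
    by simp
qed

text \<open>Replacing \<open>x\<close> by \<open>y\<close> one letter at a time gives a telescoping
  sum. Each term has one letter \<open>x - y\<close> of weight \<open>p\<close> and \<open>k\<close>
  other arguments of weight at least 1 besides the prefix. The gain by \<open>k\<close> is what
  makes the nonlinear terms contracting.\<close>

lemma replicate_diff:
  assumes "xs \<in> words V" "x \<in> V 0" "y \<in> V 0" "x - y \<in> F p 0" "1 \<le> p"
  shows "m (map snd xs @ replicate (Suc k) x) - m (map snd xs @ replicate (Suc k) y)
      \<in> F' (length xs + p + k) (deg xs + e)"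
  using assms(1)
proof (induction k arbitrary: xs)
  case 0
  then show ?case
    using mem_filtration_letter[of xs "[]" "x - y" p 0] diff_letter[of xs "[]" x 0 y] assms by simp
next
  case (Suc k)
  let ?r = "\<lambda>x. replicate (Suc k) x"
  have "m (map snd (xs @ [(0, x)]) @ ?r x) - m (map snd (xs @ [(0, x)]) @ ?r y)
      \<in> F' (length (xs @ [(0, x)]) + p + k) (deg (xs @ [(0, x)]) + e)"
    using Suc assms by (intro Suc.IH) simp
  moreover have "m (map snd xs @ (x - y) # map snd (?r (0 :: int, y)))
      \<in> F' (length xs + p + length (?r (0 :: int, y))) (deg xs + 0 + deg (?r (0 :: int, y)) + e)"
    using Suc.prems assms by (intro mem_filtration_letter) (auto simp del: replicate_Suc)
  ultimately have "(m (map snd xs @ x # ?r x) - m (map snd xs @ x # ?r y)) +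
      m (map snd xs @ (x - y) # map snd (?r (0 :: int, y))) \<in> F' (length xs + p + Suc k) (deg xs + e)"
    using assms(5) by (intro T.subspace_add T.subspace_filtration) (auto simp del: replicate_Suc)
  moreover have "m (map snd xs @ (x - y) # map snd (?r (0 :: int, y))) =
      m (map snd xs @ x # map snd (?r (0 :: int, y))) - m (map snd xs @ y # map snd (?r (0 :: int, y)))"
    using Suc.prems assms by (intro diff_letter) (auto simp del: replicate_Suc)
  ultimately show ?case
    by simp
qed

end

section \<open>Exponential series\<close>

text \<open>For \<open>x\<close> of degree 0 all terms have the degree \<open>e\<close> of
  \<open>m\<close>, so \<open>e\<close> also names the component in which the series converges. For
  the brackets the value is the curvature of \<open>x\<close>, for a morphism it is the induced map
  on Maurer-Cartan elements.\<close>

definition exp_apply ::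
    "('k::field_char_0 \<Rightarrow> 'w::ab_group_add \<Rightarrow> 'w) \<Rightarrow> (nat \<Rightarrow> int \<Rightarrow> 'w set) \<Rightarrow> int \<Rightarrow>
     ('v list \<Rightarrow> 'w) \<Rightarrow> 'v \<Rightarrow> 'w" where
  "exp_apply s F e m x = filt_sum F e 1 (\<lambda>i. s (1 / fact i) (m (replicate i x)))"

context filtered_multilinear_map
begin

lemma exp_term_mem: "x \<in> V 0 \<Longrightarrow> 1 \<le> i \<Longrightarrow> sW c (m (replicate i x)) \<in> F' i e"
  by (intro T.subspace_scale[OF T.subspace_filtration] replicate_mem_filtration)

lemma exp_apply_mem: "x \<in> V 0 \<Longrightarrow> exp_apply sW F' e m x \<in> W e"
  unfolding exp_apply_def by (intro T.filt_sum_mem exp_term_mem) auto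

text \<open>The partial sums converge to \<open>exp_apply\<close> and limits are unique. This ties
  vanishing curvature to the definition of \<open>MC\<close>, which speaks of convergence to
  0.\<close>

lemma exp_apply_eq_zero_iff:
  assumes "x \<in> V 0"
  shows "exp_apply sW F' e m x = 0 \<longleftrightarrow>
    filt_tendsto F' e (\<lambda>n. \<Sum>i=1..n. sW (1 / fact i) (m (replicate i x))) 0"
proof -
  have "filt_tendsto F' e (\<lambda>n. \<Sum>i=1..n. sW (1 / fact i) (m (replicate i x))) (exp_apply sW F' e m x)"
    unfolding exp_apply_def by (intro T.filt_sum_tendsto exp_term_mem assms) auto
  then show ?thesis
    using T.filt_tendsto_unique by auto
qed

lemma exp_apply_split_first:
  assumes "x \<in> V 0"
  shows "exp_apply sW F' e m x =
    m [x] + filt_sum F' e 2 (\<lambda>i. sW (1 / fact i) (m (replicate i x)))"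
  unfolding exp_apply_def by (subst T.filt_sum_split_first) (simp_all add: exp_term_mem[OF assms])

lemma Cons_replicate_mem_filtration:
  "c \<in> F p d \<Longrightarrow> x \<in> V 0 \<Longrightarrow> 1 \<le> p \<Longrightarrow> m (c # replicate n x) \<in> F' (p + n) (d + e)"
  using mem_filtration_letter[of "[]" "replicate n (0, x)" c p d] by simp

text \<open>For \<open>n \<ge> 1\<close> a term contains \<open>c\<close> of weight \<open>p\<close>
  and at least one \<open>x\<close> of weight 1, so it already lies in \<open>F' (Suc p)\<close>.
  Subtracting these terms isolates the linear one.\<close>

lemma singleton_mem_Suc_filtration:
  assumes "c \<in> F p d" "x \<in> V 0" "1 \<le> p"
    and "(\<Sum>n\<le>p. sW (1 / fact n) (m (c # replicate n x))) \<in> F' (Suc p) (d + e)"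
  shows "m [c] \<in> F' (Suc p) (d + e)"
proof -
  have "(\<Sum>n\<le>p. sW (1 / fact n) (m (c # replicate n x))) =
      m [c] + (\<Sum>n=1..p. sW (1 / fact n) (m (c # replicate n x)))"
    unfolding atMost_atLeast0 by (subst sum.atLeast_Suc_atMost) auto
  moreover have "(\<Sum>n=1..p. sW (1 / fact n) (m (c # replicate n x))) \<in> F' (Suc p) (d + e)"
  proof (intro T.subspace_sum T.subspace_scale T.subspace_filtration)
    fix n assume "n \<in> {1..p}"
    then show "m (c # replicate n x) \<in> F' (Suc p) (d + e)"
      using T.filtration_mono_mem[OF Cons_replicate_mem_filtration[OF assms(1-3), of n]] by simp
  qed simp_all
  ultimately show ?thesis
    using T.subspace_diff[OF T.subspace_filtration assms(4), of "\<Sum>n=1..p. sW (1 / fact n) (m (c # replicate n x))"]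
    by simp
qed

text \<open>Grouping the inserted series by total length \<open>l = n + i\<close> pairs
  \<open>n\<close> copies of \<open>x\<close> with the partial sum up to \<open>N - n\<close>. What
  is missing in its place is a remainder in \<open>F (Suc (N - n))\<close>, and the \<open>n\<close>
  copies of \<open>x\<close> raise its weight to \<open>Suc N\<close>.\<close>

lemma sum_insertions_mem_filtration:
  assumes t: "\<And>i. 1 \<le> i \<Longrightarrow> t i \<in> F i d" and x: "x \<in> V 0"
  shows "(\<Sum>n\<le>N. sW (1 / fact n) (m (filt_sum F d 1 t # replicate n x)))
      - (\<Sum>l=1..N. \<Sum>i=1..l. sW (1 / fact (l - i)) (m (t i # replicate (l - i) x)))
    \<in> F' (Suc N) (d + e)"
proof -
  let ?c = "filt_sum F d 1 t"
  have tV: "t i \<in> V d" if "1 \<le> i" for i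
    using t[OF that] S.filtration_subset[OF that] by blast
  have cV: "?c \<in> V d"
    using t by (intro S.filt_sum_mem) auto
  have sV: "(\<Sum>i=1..M. t i) \<in> V d" for M
    using tV by (intro S.subspace_sum S.subspace_component) auto
  have "(\<Sum>l=1..N. \<Sum>i=1..l. sW (1 / fact (l - i)) (m (t i # replicate (l - i) x))) =
      (\<Sum>(l, i)\<in>(SIGMA l:{1..N}. {1..l}). sW (1 / fact (l - i)) (m (t i # replicate (l - i) x)))"
    by (subst sum.Sigma) auto
  \<comment> \<open>Substitute \<open>n = l - i\<close>: the triangle of pairs with
    \<open>i \<le> l \<le> N\<close> becomes the one with \<open>n + i \<le> N\<close>.\<close>
  also have "\<dots> = (\<Sum>(n, i)\<in>(SIGMA n:{..N}. {1..N - n}). sW (1 / fact n) (m (t i # replicate n x)))"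
    by (rule sum.reindex_bij_witness[where i = "\<lambda>(n, i). (n + i, i)" and j = "\<lambda>(l, i). (l - i, i)"])
       auto
  also have "\<dots> = (\<Sum>n\<le>N. \<Sum>i=1..N - n. sW (1 / fact n) (m (t i # replicate n x)))"
    by (subst sum.Sigma) auto
  also have "\<dots> = (\<Sum>n\<le>N. sW (1 / fact n) (m ((\<Sum>i=1..N - n. t i) # replicate n x)))"
    using sum_letter[of "[]" "replicate _ (0, x)" "{1.._}" t d] tV x
    by (intro sum.cong refl) (simp add: T.scale_sum_right)
  finally have "(\<Sum>n\<le>N. sW (1 / fact n) (m (?c # replicate n x)))
      - (\<Sum>l=1..N. \<Sum>i=1..l. sW (1 / fact (l - i)) (m (t i # replicate (l - i) x))) =
      (\<Sum>n\<le>N. sW (1 / fact n) (m ((?c - (\<Sum>i=1..N - n. t i)) # replicate n x)))"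
    using diff_letter[of "[]" "replicate _ (0, x)" ?c d] x cV sV
    by (simp add: sum_subtractf[symmetric] T.scale_right_diff_distrib)
  also have "\<dots> \<in> F' (Suc N) (d + e)"
  proof (intro T.subspace_sum T.subspace_scale T.subspace_filtration)
    fix n assume "n \<in> {..N}"
    then show "m ((?c - (\<Sum>i=1..N - n. t i)) # replicate n x) \<in> F' (Suc N) (d + e)"
      using Cons_replicate_mem_filtration[OF S.filt_sum_remainder(2)[of 1 t d "N - n"] x, of n] t by simp
  qed simp_all
  finally show ?thesis .
qed

text \<open>Replace the series by its partial sum up to \<open>N\<close>, at an error in
  \<open>F' (Suc N)\<close>, and expand the power over lists of indices. Lists of sum at most
  \<open>N\<close> are the compositions; all others have weight above \<open>N\<close>.\<close>

lemma sum_compositions_mem_filtration: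
  assumes t: "\<And>i. 1 \<le> i \<Longrightarrow> t i \<in> F i 0" and k: "1 \<le> k"
  shows "m (replicate k (filt_sum F 0 1 t)) - (\<Sum>l=1..N. \<Sum>is\<in>compositions k l. m (map t is))
    \<in> F' (Suc N) e"
proof -
  let ?z = "filt_sum F 0 1 t" and ?s = "\<Sum>i=1..N. t i"
  let ?L = "{is. set is \<subseteq> {1..N} \<and> length is = k}" and ?C = "\<Union>l\<in>{1..N}. compositions k l"
  have tV: "t i \<in> V 0" if "1 \<le> i" for i
    using t[OF that] S.filtration_subset[OF that] by blast
  have zV: "?z \<in> V 0"
    using t by (intro S.filt_sum_mem) auto
  have sV: "?s \<in> V 0"
    using tV by (intro S.subspace_sum S.subspace_component) auto
  have finL: "finite ?L"
    by (simp add: finite_lists_length_eq)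
  obtain j where j: "k = Suc j"
    using k by (cases k) auto
  have "m (replicate k ?z) - m (replicate k ?s) \<in> F' (Suc N + j) e"
    using replicate_diff[of "[]" ?z ?s "Suc N" j] zV sV S.filt_sum_remainder(2)[of 1 t 0 N] t j by simp
  then have 1: "m (replicate k ?z) - m (replicate k ?s) \<in> F' (Suc N) e"
    by (rule T.filtration_mono_mem) auto
  have "m (replicate k ?s) = (\<Sum>is\<in>?L. m (map t is))"
    using replicate_sum[of "[]" "{1..N}" t k] tV by simp
  also have "\<dots> = (\<Sum>is\<in>?L - ?C. m (map t is)) + (\<Sum>is\<in>?C. m (map t is))"
    using member_le_sum_list by (intro sum.subset_diff finL) (fastforce simp: compositions_def)
  also have "(\<Sum>is\<in>?C. m (map t is)) = (\<Sum>l=1..N. \<Sum>is\<in>compositions k l. m (map t is))"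
    by (intro sum.UNION_disjoint) (auto simp: finite_compositions, auto simp: compositions_def)
  finally have 2: "m (replicate k ?s) - (\<Sum>l=1..N. \<Sum>is\<in>compositions k l. m (map t is)) =
      (\<Sum>is\<in>?L - ?C. m (map t is))"
    by simp
  have 3: "(\<Sum>is\<in>?L - ?C. m (map t is)) \<in> F' (Suc N) e"
  proof (intro T.subspace_sum T.subspace_filtration)
    fix js assume js: "js \<in> ?L - ?C"
    then have ne: "js \<noteq> []" "\<And>i. i \<in> set js \<Longrightarrow> 1 \<le> i"
      using k by auto
    then have "1 \<le> sum_list js"
      by (cases js) (auto intro: trans_le_add1)
    then have "Suc N \<le> sum_list js"
      using js ne(2) by (force simp: compositions_def)
    then show "m (map t js) \<in> F' (Suc N) e"
      using mem_filtration_map[OF ne t] ne(2) T.filtration_mono_mem by (metis le_add1 plus_1_eq_Suc)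
  qed simp
  show ?thesis
    using T.subspace_add[OF T.subspace_filtration 1 3[folded 2]] by simp
qed

text \<open>There is no composition of \<open>l\<close> into more than \<open>l\<close> positive
  parts. The triangular range of \<open>k\<close> and \<open>l\<close> may thus be enlarged to a
  square and the sums exchanged.\<close>

lemma sum_exp_compositions_mem_filtration:
  assumes t: "\<And>i. 1 \<le> i \<Longrightarrow> t i \<in> F i 0"
  shows "(\<Sum>k=1..N. sW (1 / fact k) (m (replicate k (filt_sum F 0 1 t))))
      - (\<Sum>l=1..N. \<Sum>k=1..l. \<Sum>is\<in>compositions k l. sW (1 / fact k) (m (map t is)))
    \<in> F' (Suc N) e"
proof -
  let ?a = "\<lambda>k l. \<Sum>is\<in>compositions k l. sW (1 / fact k) (m (map t is))"
  have empty: "compositions k l = {}" if "l < k" for k l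
  proof -
    have "length is \<le> sum_list is" if "\<forall>i\<in>set is. 1 \<le> i" for "is" :: "nat list"
      using that by (induction "is") auto
    then show ?thesis
      using that by (fastforce simp: compositions_def)
  qed
  have "(\<Sum>l=1..N. \<Sum>k=1..l. ?a k l) = (\<Sum>l=1..N. \<Sum>k=1..N. ?a k l)"
    by (intro sum.cong refl sum.mono_neutral_left) (auto simp: empty)
  also have "\<dots> = (\<Sum>k=1..N. \<Sum>l=1..N. ?a k l)"
    by (rule sum.swap)
  finally have "(\<Sum>k=1..N. sW (1 / fact k) (m (replicate k (filt_sum F 0 1 t))))
      - (\<Sum>l=1..N. \<Sum>k=1..l. ?a k l) =
      (\<Sum>k=1..N. sW (1 / fact k) (m (replicate k (filt_sum F 0 1 t))
        - (\<Sum>l=1..N. \<Sum>is\<in>compositions k l. m (map t is))))"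
    by (simp add: sum_subtractf T.scale_right_diff_distrib T.scale_sum_right)
  also have "\<dots> \<in> F' (Suc N) e"
    using sum_compositions_mem_filtration[OF t]
    by (intro T.subspace_sum T.subspace_scale T.subspace_filtration) auto
  finally show ?thesis .
qed

end

section \<open>The Maurer-Cartan equation under morphisms\<close>

locale filtered_coderivation = filtered_multilinear_map s V F s V F 1 q
  for s :: "'k::field_char_0 \<Rightarrow> 'v::ab_group_add \<Rightarrow> 'v" and V F q +
  assumes square_zero: "\<And>ws. ws \<in> words V \<Longrightarrow> ws \<noteq> [] \<Longrightarrow>
    sym_eq s V (lin_ext tscale (coder q) (coder q ws)) 0"
begin

abbreviation curvature :: "'v \<Rightarrow> 'v" where
  "curvature \<equiv> exp_apply s F 1 q"

text \<open>Project \<open>Q Q = 0\<close> at the n-th power of \<open>x\<close> to length one and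
  divide by \<open>n!\<close>. The binomial coefficient splits into \<open>1 / i!\<close> on the
  inner bracket and \<open>1 / (n - i)!\<close> outside, as needed for inserting the curvature
  series.\<close>

lemma square_zero_replicate:
  assumes x: "x \<in> V 0" and n: "1 \<le> n"
  shows "(\<Sum>i=1..n. s (1 / fact (n - i))
    (q (s (1 / fact i) (q (replicate i x)) # replicate (n - i) x))) = 0"
proof -
  let ?ws = "replicate n (0, x)"
  have "lin_ext s word_proj (lin_ext tscale (coder q) (coder q ?ws)) = 0"
    using sym_eq_word_proj[OF S.vector_space_axioms square_zero[of ?ws]] x n by simp
  then have "(\<Sum>i=1..n. s (fact n / (fact i * fact (n - i)))
      (q (q (replicate i x) # replicate (n - i) x))) = 0"
    by (simp add: S.lin_ext_lin_ext lin_ext_coder_replicate[OF S.vector_space_axioms] S.word_proj_coder)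
  then have "s (1 / fact n) (\<Sum>i=1..n. s (fact n / (fact i * fact (n - i)))
      (q (q (replicate i x) # replicate (n - i) x))) = 0"
    by simp
  moreover have "q (s (1 / fact i) (q (replicate i x)) # replicate (n - i) x) =
      s (1 / fact i) (q (q (replicate i x) # replicate (n - i) x))" if "1 \<le> i" for i
    using scale_letter[of "[]" "replicate (n - i) (0, x)" "q (replicate i x)" 1]
      mem_component[of "replicate i (0, x)"] x that by simp
  ultimately show ?thesis
    by (simp add: S.scale_sum_right mult.commute)
qed

lemma curvature_mem: "x \<in> V 0 \<Longrightarrow> curvature x \<in> V 1"
  by (rule exp_apply_mem)

text \<open>The truncated Bianchi identity: the regrouped insertions of the curvature vanish in each
  length, so only the error in \<open>F (Suc p)\<close> remains, and the linear term can be
  isolated.\<close>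

lemma coderivation_curvature_mem_filtration:
  assumes x: "x \<in> V 0" and p: "1 \<le> p" "curvature x \<in> F p 1"
  shows "q [curvature x] \<in> F (Suc p) 2"
proof -
  have "(\<Sum>n\<le>p. s (1 / fact n) (q (curvature x # replicate n x))) \<in> F (Suc p) (1 + 1)"
    using sum_insertions_mem_filtration[of "\<lambda>i. s (1 / fact i) (q (replicate i x))" 1 x p]
      exp_term_mem[OF x] x square_zero_replicate
    by (simp add: exp_apply_def)
  then show ?thesis
    using singleton_mem_Suc_filtration[OF p(2) x p(1)] by simp
qed

end

locale filtered_coalgebra_morphism =
  R: filtered_coderivation sW W FW r + Q: filtered_coderivation sV V FV q +
  filtered_multilinear_map sW W FW sV V FV 0 f
  for sW :: "'k::field_char_0 \<Rightarrow> 'w::ab_group_add \<Rightarrow> 'w" and W FW r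
    and sV :: "'k \<Rightarrow> 'v::ab_group_add \<Rightarrow> 'v" and V FV q f +
  assumes morphism: "\<And>ws. ws \<in> words W \<Longrightarrow> ws \<noteq> [] \<Longrightarrow>
    sym_eq sV V (lin_ext tscale (mor f) (coder r ws)) (lin_ext tscale (coder q) (mor f ws))"
begin

abbreviation push :: "'w \<Rightarrow> 'v" where
  "push \<equiv> exp_apply sV FV 0 f"

text \<open>Project \<open>F R = Q F\<close> at the n-th power of \<open>x\<close> to length one and
  divide by \<open>n!\<close>. Multilinearity moves the factors \<open>1 / i!\<close> into the inner
  maps, which gives an insertion sum on the left and a sum over compositions on the right.\<close>

lemma morphism_replicate:
  assumes x: "x \<in> W 0" and n: "1 \<le> n"
  shows "(\<Sum>i=1..n. sV (1 / fact (n - i))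
      (f (sW (1 / fact i) (r (replicate i x)) # replicate (n - i) x))) =
    (\<Sum>k=1..n. \<Sum>is\<in>compositions k n. sV (1 / fact k)
      (q (map (\<lambda>i. sV (1 / fact i) (f (replicate i x))) is)))"
proof -
  let ?ws = "replicate n (0, x)"
  have "lin_ext sV word_proj (lin_ext tscale (mor f) (coder r ?ws)) =
      lin_ext sV word_proj (lin_ext tscale (coder q) (mor f ?ws))"
    using sym_eq_word_proj[OF Q.S.vector_space_axioms morphism[of ?ws]] x n by simp
  moreover have "lin_ext sV word_proj (lin_ext tscale (mor f) (coder r ?ws)) =
      (\<Sum>i=1..n. sV (fact n / (fact i * fact (n - i))) (f (r (replicate i x) # replicate (n - i) x)))"
    by (simp add: Q.S.lin_ext_lin_ext lin_ext_coder_replicate[OF Q.S.vector_space_axioms]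
        word_proj_mor[OF Q.S.vector_space_axioms])
  moreover have "lin_ext sV word_proj (lin_ext tscale (coder q) (mor f ?ws)) =
      (\<Sum>k=1..n. \<Sum>is\<in>compositions k n. sV (fact n / (\<Prod>i\<leftarrow>is. fact i) / fact k)
        (q (map (\<lambda>i. f (replicate i x)) is)))"
    unfolding Q.S.lin_ext_lin_ext mor_def Q.S.lin_ext_sum
      lin_ext_mor_comp_replicate[OF Q.S.vector_space_axioms] length_replicate
    by (intro sum.cong refl) (auto simp: Q.S.word_proj_coder compositions_def o_def Suc_le_eq)
  ultimately have eq: "(\<Sum>i=1..n. sV (1 / fact n) (sV (fact n / (fact i * fact (n - i)))
        (f (r (replicate i x) # replicate (n - i) x)))) =
      (\<Sum>k=1..n. \<Sum>is\<in>compositions k n. sV (1 / fact n) (sV (fact n / (\<Prod>i\<leftarrow>is. fact i) / fact k)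
        (q (map (\<lambda>i. f (replicate i x)) is))))"
    by (simp add: Q.S.scale_sum_right[symmetric] del: Q.S.scale_scale)
  have 1: "sV (1 / fact (n - i)) (f (sW (1 / fact i) (r (replicate i x)) # replicate (n - i) x)) =
      sV (1 / fact n) (sV (fact n / (fact i * fact (n - i)))
        (f (r (replicate i x) # replicate (n - i) x)))" if "1 \<le> i" for i
    using scale_letter[of "[]" "replicate (n - i) (0, x)" "r (replicate i x)" 1]
      R.mem_component[of "replicate i (0, x)"] x that by (simp add: mult.commute)
  have 2: "sV (1 / fact k) (q (map (\<lambda>i. sV (1 / fact i) (f (replicate i x))) is)) =
      sV (1 / fact n) (sV (fact n / (\<Prod>i\<leftarrow>is. fact i) / fact k)
        (q (map (\<lambda>i. f (replicate i x)) is)))" if "is \<in> compositions k n" for k "is"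
  proof -
    have prod: "(\<Prod>i\<leftarrow>is. 1 / fact i :: 'k) = 1 / (\<Prod>i\<leftarrow>is. fact i)" for "is" :: "nat list"
      by (induction "is") auto
    have "f (replicate i x) \<in> V 0" if "i \<in> set is" for i
      using \<open>is \<in> compositions k n\<close> that mem_component[of "replicate i (0, x)"] x
      by (auto simp: compositions_def)
    then have "q (map (\<lambda>i. sV (1 / fact i) (f (replicate i x))) is) =
        sV (1 / (\<Prod>i\<leftarrow>is. fact i)) (q (map (\<lambda>i. f (replicate i x)) is))"
      using Q.map_scale[of "[]" "is" "\<lambda>i. f (replicate i x)" "\<lambda>i. 1 / fact i"] prod by simp
    then show ?thesis
      by (simp add: mult.commute)
  qed
  show ?thesis
    using eq 1 2 by simp
qed

text \<open>The derivative of the morphism at \<open>x\<close>, applied to the curvature of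
  \<open>x\<close>, is the curvature of the image. Both truncations are congruent to double sums
  that agree length by length.\<close>

lemma curvature_push_mem_filtration:
  assumes x: "x \<in> W 0"
  shows "(\<Sum>n\<le>N. sV (1 / fact n) (f (R.curvature x # replicate n x)))
      - (\<Sum>k=1..N. sV (1 / fact k) (q (replicate k (push x)))) \<in> FV (Suc N) 1"
proof -
  let ?r = "\<lambda>i. sW (1 / fact i) (r (replicate i x))" and ?f = "\<lambda>i. sV (1 / fact i) (f (replicate i x))"
  have "(\<Sum>n\<le>N. sV (1 / fact n) (f (R.curvature x # replicate n x)))
      - (\<Sum>l=1..N. \<Sum>i=1..l. sV (1 / fact (l - i)) (f (?r i # replicate (l - i) x))) \<in> FV (Suc N) 1"
    using sum_insertions_mem_filtration[of ?r 1 x N] R.exp_term_mem[OF x] x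
    by (simp add: exp_apply_def)
  moreover have "(\<Sum>k=1..N. sV (1 / fact k) (q (replicate k (push x))))
      - (\<Sum>l=1..N. \<Sum>k=1..l. \<Sum>is\<in>compositions k l. sV (1 / fact k) (q (map ?f is)))
      \<in> FV (Suc N) 1"
    using Q.sum_exp_compositions_mem_filtration[of ?f N] exp_term_mem[OF x]
    by (simp add: exp_apply_def)
  moreover have "(\<Sum>l=1..N. \<Sum>i=1..l. sV (1 / fact (l - i)) (f (?r i # replicate (l - i) x))) =
      (\<Sum>l=1..N. \<Sum>k=1..l. \<Sum>is\<in>compositions k l. sV (1 / fact k) (q (map ?f is)))"
    by (intro sum.cong refl morphism_replicate x) simp
  ultimately show ?thesis
    using Q.S.subspace_diff[OF Q.S.subspace_filtration[of "Suc N" 1]] by fastforce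
qed

text \<open>Inserting curvature 0 gives 0, so the partial sums of the curvature of the image are
  themselves remainders.\<close>

lemma curvature_push_eq_zero:
  assumes x: "x \<in> W 0" and "R.curvature x = 0"
  shows "Q.curvature (push x) = 0"
  unfolding exp_apply_def[of sV FV 1]
proof (rule Q.S.filt_sum_eqI)
  fix N
  have "f (0 # replicate n x) = 0" for n
    using zero_letter[of "[]" "replicate n (0, x)"] x by simp
  then show "0 - (\<Sum>k=1..N. sV (1 / fact k) (q (replicate k (push x)))) \<in> FV (Suc N) 1"
    using curvature_push_mem_filtration[OF x, of N] assms(2) by simp
qed simp

text \<open>A partial converse to preservation of Maurer-Cartan elements: if the image has curvature
  0, the insertions of the curvature of \<open>x\<close> are small, and the linear one inherits the
  gain. It is applied below to the morphism \<open>g\<close>.\<close>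

lemma linear_part_curvature_mem_filtration:
  assumes x: "x \<in> W 0" and "Q.curvature (push x) = 0"
    and p: "1 \<le> p" "R.curvature x \<in> FW p 1"
  shows "f [R.curvature x] \<in> FV (Suc p) 1"
proof -
  have "push x \<in> V 0"
    by (rule exp_apply_mem[OF x])
  then have "Q.curvature (push x) - (\<Sum>k=1..p. sV (1 / fact k) (q (replicate k (push x)))) \<in> FV (Suc p) 1"
    unfolding exp_apply_def[of sV FV 1]
    by (intro Q.S.filt_sum_remainder Q.exp_term_mem) auto
  then have "(\<Sum>n\<le>p. sV (1 / fact n) (f (R.curvature x # replicate n x))) \<in> FV (Suc p) 1"
    using Q.S.subspace_diff[OF Q.S.subspace_filtration curvature_push_mem_filtration[OF x, of p],
        of "0 - (\<Sum>k=1..p. sV (1 / fact k) (q (replicate k (push x))))"] assms(2)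
    by simp
  then show ?thesis
    using singleton_mem_Suc_filtration[OF p(2) x p(1)] by simp
qed

end

section \<open>Maurer-Cartan elements and contractions\<close>

text \<open>Here \<open>V\<close> and \<open>W\<close> are the spaces that the paper calls \<open>V[1]\<close> and \<open>W[1]\<close>, so that
  Maurer-Cartan elements have degree 0 and curvatures have degree 1.\<close>

locale contraction_transfer =
  F: filtered_coalgebra_morphism sW W "pullback_filtration W FV f1" r sV V FV q f +
  G: filtered_coalgebra_morphism sV V FV q sW W "pullback_filtration W FV f1" r g
  for sV :: "'k::field_char_0 \<Rightarrow> 'v::ab_group_add \<Rightarrow> 'v" and V FV q
    and sW :: "'k \<Rightarrow> 'w::ab_group_add \<Rightarrow> 'w" and W r dW f1 g1 K f g +
  assumes contraction: "complete_contraction sV V FV (\<lambda>v. q [v]) sW W dW f1 g1 K"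
    and f_linear_part: "\<And>y. y \<in> W 0 \<Longrightarrow> f [y] = f1 y"
    and g_linear_part: "\<And>k x. x \<in> V k \<Longrightarrow> g [x] = g1 x"
    and f_mem_image: "\<And>y i. y \<in> W 0 \<Longrightarrow> 2 \<le> i \<Longrightarrow> f (replicate i y) \<in> K ` V 1"
    and g_eq_zero: "\<And>x i. x \<in> V 0 \<Longrightarrow> K x = 0 \<Longrightarrow> 2 \<le> i \<Longrightarrow> g (replicate i x) = 0"
begin

abbreviation FW :: "nat \<Rightarrow> int \<Rightarrow> 'w set" where
  "FW \<equiv> pullback_filtration W FV f1"

abbreviation MC_V :: "'v set" where
  "MC_V \<equiv> {x \<in> V 0. F.Q.curvature x = 0}"

abbreviation MC_W :: "'w set" where
  "MC_W \<equiv> {y \<in> W 0. F.R.curvature y = 0}"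

lemmas VS = F.Q.S.vector_space_axioms and WS = F.R.S.vector_space_axioms

lemma K_graded_linear: "graded_linear sV V sV V (- 1) K"
  and f1_graded_linear: "graded_linear sW W sV V 0 f1"
  and g1_graded_linear: "graded_linear sV V sW W 0 g1"
  using contraction by (simp_all add: complete_contraction_def)

lemma K_mem: "x \<in> V k \<Longrightarrow> K x \<in> V (k - 1)"
  and f1_mem: "w \<in> W k \<Longrightarrow> f1 w \<in> V k"
  and g1_mem: "x \<in> V k \<Longrightarrow> g1 x \<in> W k"
  using K_graded_linear f1_graded_linear g1_graded_linear
  unfolding graded_linear_def by (metis add_uminus_conv_diff add.right_neutral)+

lemmas K_add = graded_linear_add_diff(1)[OF K_graded_linear VS VS]
  and K_diff = graded_linear_add_diff(2)[OF K_graded_linear VS VS]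
  and K_scale = graded_linear_scale[OF K_graded_linear VS VS]
  and f1_add = graded_linear_add_diff(1)[OF f1_graded_linear WS VS]
  and f1_diff = graded_linear_add_diff(2)[OF f1_graded_linear WS VS]
  and f1_scale = graded_linear_scale[OF f1_graded_linear WS VS]
  and g1_add = graded_linear_add_diff(1)[OF g1_graded_linear VS WS]
  and g1_diff = graded_linear_add_diff(2)[OF g1_graded_linear VS WS]
  and g1_scale = graded_linear_scale[OF g1_graded_linear VS WS]

lemma g1_f1: "w \<in> W k \<Longrightarrow> g1 (f1 w) = w"
  and K_f1: "w \<in> W k \<Longrightarrow> K (f1 w) = 0"
  and K_K: "x \<in> V k \<Longrightarrow> K (K x) = 0"
  and g1_K: "x \<in> V k \<Longrightarrow> g1 (K x) = 0"
  and homotopy: "x \<in> V k \<Longrightarrow> K (q [x]) + q [K x] = f1 (g1 x) - x"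
  and g1_q: "x \<in> V k \<Longrightarrow> g1 (q [x]) = dW (g1 x)"
  using contraction by (auto simp: complete_contraction_def)

lemma q_mem: "x \<in> V k \<Longrightarrow> q [x] \<in> V (k + 1)"
  using F.Q.mem_component[of "[(k, x)]"] by simp

lemma K_filtration: "1 \<le> p \<Longrightarrow> x \<in> FV p k \<Longrightarrow> K x \<in> FV p (k - 1)"
  and f1_g1_filtration: "1 \<le> p \<Longrightarrow> x \<in> FV p k \<Longrightarrow> f1 (g1 x) \<in> FV p k"
  using contraction by (auto simp: complete_contraction_def)

lemma f1_filtration: "w \<in> FW p k \<Longrightarrow> f1 w \<in> FV p k"
  by (simp add: pullback_filtration_def)

lemma g1_filtration: "1 \<le> p \<Longrightarrow> x \<in> FV p k \<Longrightarrow> g1 x \<in> FW p k"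
  using f1_g1_filtration[of p x k] g1_mem[of x k] F.Q.S.filtration_subset[of p k]
  by (auto simp: pullback_filtration_def)

text \<open>In the homotopy formula at \<open>K v\<close> the terms with \<open>K K\<close> and
  \<open>g1 K\<close> vanish; for the second claim \<open>g1\<close> commutes with the
  differentials. This explains the summand \<open>- q [u]\<close> of the recursion: it contributes
  \<open>u\<close> under \<open>K\<close> and nothing under \<open>g1\<close>.\<close>

lemma q_Kv:
  assumes "v \<in> V k"
  shows "K (q [K v]) = - K v" "g1 (q [K v]) = 0"
proof -
  have Kv: "K v \<in> V (k - 1)"
    using assms by (rule K_mem)
  have zero: "q [0] = 0" "f1 0 = 0" "dW 0 = 0"
    using F.Q.zero_letter[of "[]" "[]"] f1_diff[of 0 0 0] g1_q[of 0 0] g1_diff[of 0 0 0]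
    by simp_all
  show "K (q [K v]) = - K v"
    using homotopy[OF Kv] K_K[OF assms] g1_K[OF assms] zero by simp
  show "g1 (q [K v]) = 0"
    using g1_q[OF Kv] g1_K[OF assms] zero by simp
qed

text \<open>As a single filtered multilinear map of degree 0 it makes the estimate
  \<open>replicate_diff\<close> available for the nonlinear part of the recursion.\<close>

definition higher :: "'v list \<Rightarrow> 'v" where
  "higher xs = K (q xs) - f1 (g xs)"

lemma filtered_multilinear_higher: "filtered_multilinear_map sV V FV sV V FV 0 higher"
proof unfold_locales
  show "filtered_family V FV FV 0 higher"
    unfolding filtered_family_def
  proof (intro ballI allI impI, elim conjE)
    fix ws and ps :: "nat list"
    assume ws: "ws \<in> words V" "ws \<noteq> []" "length ps = length ws"
      and ps: "\<forall>j<length ws. 1 \<le> ps ! j \<and> snd (ws ! j) \<in> FV (ps ! j) (fst (ws ! j))"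
    have "q (map snd ws) \<in> FV (sum_list ps) (deg ws + 1)"
      by (intro F.Q.filtered[unfolded filtered_family_def, THEN bspec, THEN spec, THEN mp] conjI ws ps)
    moreover have "g (map snd ws) \<in> FW (sum_list ps) (deg ws + 0)"
      by (intro G.filtered[unfolded filtered_family_def, THEN bspec, THEN spec, THEN mp] conjI ws ps)
    \<comment> \<open>The filtration carries information only from index 1 on, so the total weight
      must be positive.\<close>
    moreover have "1 \<le> sum_list ps"
    proof -
      have "ps ! 0 \<in> set ps" "1 \<le> ps ! 0"
        using ws ps by auto
      then show ?thesis
        using member_le_sum_list[of "ps ! 0" ps] by simp
    qed
    ultimately show "higher (map snd ws) \<in> FV (sum_list ps) (deg ws + 0)"
      unfolding higher_def
      using K_filtration[of "sum_list ps" _ "deg ws + 1"]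
      by (intro F.Q.S.subspace_diff F.Q.S.subspace_filtration f1_filtration) auto
  qed
next
  fix xs ys d a b x y
  assume *: "xs \<in> words V" "ys \<in> words V" "x \<in> V d" "y \<in> V d"
  let ?w = "\<lambda>x. map snd xs @ x # map snd ys" and ?k = "deg xs + d + deg ys"
  have q: "q (?w z) \<in> V (?k + 1)" and g: "g (?w z) \<in> W ?k" if "z \<in> V d" for z
    using F.Q.mem_component[of "xs @ (d, z) # ys"] G.mem_component[of "xs @ (d, z) # ys"] * that
    by (simp_all add: add.assoc)
  have qs: "sV c (q (?w z)) \<in> V (?k + 1)" and gs: "sW c (g (?w z)) \<in> W ?k" if "z \<in> V d" for z c
    using q[OF that] g[OF that] F.Q.S.subspace_scale[OF F.Q.S.subspace_component]
      F.R.S.subspace_scale[OF F.R.S.subspace_component] by blast+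
  show "higher (?w (sV a x + sV b y)) = sV a (higher (?w x)) + sV b (higher (?w y))"
    unfolding higher_def F.Q.linear[OF *] G.linear[OF *]
    using K_add[OF qs[OF *(3)] qs[OF *(4)]] f1_add[OF gs[OF *(3)] gs[OF *(4)]]
      K_scale[OF q[OF *(3)]] K_scale[OF q[OF *(4)]] f1_scale[OF g[OF *(3)]] f1_scale[OF g[OF *(4)]]
    by (simp add: F.Q.S.scale_right_diff_distrib)
qed

sublocale H: filtered_multilinear_map sV V FV sV V FV 0 higher
  by (rule filtered_multilinear_higher)

section \<open>The recursion as a fixed point problem\<close>

definition step :: "'w \<Rightarrow> 'v \<Rightarrow> 'v \<Rightarrow> 'v" where
  "step y u x = f1 y - q [u] + filt_sum FV 0 2 (\<lambda>i. sV (1 / fact i) (higher (replicate i x)))"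

lemma step_mem:
  assumes "y \<in> W 0" "u \<in> V (- 1)" "x \<in> V 0"
  shows "step y u x \<in> V 0"
  unfolding step_def using f1_mem[OF assms(1)] q_mem[OF assms(2)]
  by (intro F.Q.S.subspace_add F.Q.S.subspace_diff F.Q.S.subspace_component F.Q.S.filt_sum_mem
      H.exp_term_mem assms) auto

text \<open>The affine part cancels. In a power with \<open>i \<ge> 2\<close> at least one letter
  accompanies the difference and supplies the extra step of the filtration.\<close>

lemma step_contracting:
  assumes "1 \<le> p" "x \<in> V 0" "x' \<in> V 0" "x - x' \<in> FV p 0"
  shows "step y u x - step y u x' \<in> FV (Suc p) 0"
proof -
  have "sV (1 / fact i) (higher (replicate i x)) - sV (1 / fact i) (higher (replicate i x'))
      \<in> FV (Suc p) 0" if i: "2 \<le> i" for i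
  proof -
    obtain j where j: "i = Suc j" "1 \<le> j"
      using i by (cases i) auto
    have "higher (replicate i x) - higher (replicate i x') \<in> FV (p + j) 0"
      using H.replicate_diff[of "[]" x x' p j] assms j by simp
    then have "higher (replicate i x) - higher (replicate i x') \<in> FV (Suc p) 0"
      by (rule F.Q.S.filtration_mono_mem) (use j in auto)
    then show ?thesis
      using F.Q.S.subspace_scale[OF F.Q.S.subspace_filtration]
      by (simp add: F.Q.S.scale_right_diff_distrib[symmetric])
  qed
  then show ?thesis
    unfolding step_def using assms
    by (simp, intro F.Q.S.filt_sum_diff_mem H.exp_term_mem) auto
qed

text \<open>\<open>K\<close> and \<open>f1\<close> are filtered and additive, so they can be pulled
  out of the series. The series from 2 on are then the full ones minus their linear terms.\<close>

lemma step_eq: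
  assumes x: "x \<in> V 0"
  shows "step y u x = f1 y - q [u] + (K (F.Q.curvature x - q [x]) - f1 (G.push x - g1 x))"
proof -
  let ?q = "\<lambda>i. sV (1 / fact i) (q (replicate i x))"
  let ?g = "\<lambda>i. sW (1 / fact i) (g (replicate i x))"
  have q: "?q i \<in> FV i 1" and g: "?g i \<in> FW i 0" if "2 \<le> i" for i
    using F.Q.exp_term_mem[OF x] G.exp_term_mem[OF x] that by auto
  have qV: "q (replicate i x) \<in> V 1" and gW: "g (replicate i x) \<in> W 0" if "2 \<le> i" for i
    using F.Q.mem_component[of "replicate i (0, x)"] G.mem_component[of "replicate i (0, x)"] x that
    by auto
  have Kq: "K (filt_sum FV 1 2 ?q) = filt_sum FV 0 2 (\<lambda>i. K (?q i))"
    using q K_add[of _ 1] K_filtration[of _ _ 1]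
    by (intro F.Q.S.filt_sum_linear[OF _ _ F.Q.S.complete_space_axioms]) auto
  have fg: "f1 (filt_sum FW 0 2 ?g) = filt_sum FV 0 2 (\<lambda>i. f1 (?g i))"
    using g f1_add[of _ 0] f1_filtration
    by (intro F.R.S.filt_sum_linear[OF _ _ F.Q.S.complete_space_axioms]) auto
  have "K (filt_sum FV 1 2 ?q) - f1 (filt_sum FW 0 2 ?g) = filt_sum FV 0 2 (\<lambda>i. K (?q i) - f1 (?g i))"
    unfolding Kq fg using K_filtration[of _ _ 1] q f1_filtration[OF g]
    by (intro F.Q.S.filt_sum_minus[symmetric]) force+
  also have "\<dots> = filt_sum FV 0 2 (\<lambda>i. sV (1 / fact i) (higher (replicate i x)))"
  proof (rule F.Q.S.filt_sum_eqI)
    show "filt_sum FV 0 2 (\<lambda>i. sV (1 / fact i) (higher (replicate i x))) \<in> V 0"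
      by (intro F.Q.S.filt_sum_mem H.exp_term_mem x) auto
    have "(\<Sum>i=2..N. K (?q i) - f1 (?g i)) = (\<Sum>i=2..N. sV (1 / fact i) (higher (replicate i x)))" for N
      using K_scale[OF qV] f1_scale[OF gW]
      by (intro sum.cong refl) (simp add: higher_def F.Q.S.scale_right_diff_distrib)
    then show "filt_sum FV 0 2 (\<lambda>i. sV (1 / fact i) (higher (replicate i x)))
        - (\<Sum>i=2..N. K (?q i) - f1 (?g i)) \<in> FV (Suc N) 0" for N
      using F.Q.S.filt_sum_remainder(2)[of 2 "\<lambda>i. sV (1 / fact i) (higher (replicate i x))" 0 N]
        H.exp_term_mem[OF x] by simp
  qed
  finally show ?thesis
    unfolding step_def using F.Q.exp_apply_split_first[OF x] G.exp_apply_split_first[OF x]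
      g_linear_part[OF x] by simp
qed

text \<open>With curvature 0 the step is \<open>- q [K x] - K (q [x]) + f1 (g1 x)\<close>, because
  the two terms \<open>f1 (G.push x)\<close> cancel. The homotopy formula evaluates this to
  \<open>x\<close>.\<close>

lemma step_fixes_MC:
  assumes x: "x \<in> V 0" "F.Q.curvature x = 0"
  shows "step (G.push x) (K x) x = x"
proof -
  have "K (F.Q.curvature x - q [x]) = - K (q [x])"
    using x(2) K_diff[of 0 1 "q [x]"] K_diff[of 0 1 0] q_mem[OF x(1)] by simp
  moreover have "f1 (G.push x - g1 x) = f1 (G.push x) - f1 (g1 x)"
    using G.exp_apply_mem[OF x(1)] g1_mem[OF x(1)] by (rule f1_diff)
  moreover have "f1 (g1 x) = x + (K (q [x]) + q [K x])"
    using homotopy[OF x(1)] by simp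
  ultimately show ?thesis
    by (simp add: step_eq[OF x(1)])
qed

section \<open>Fixed points of the recursion are Maurer-Cartan elements with the prescribed
  coordinates\<close>

context
  fixes x y v
  assumes x: "x \<in> V 0" and y: "y \<in> W 0" and v: "v \<in> V 0" and fixed: "step y (K v) x = x"
begin

lemma fixed_point_mems:
  "F.Q.curvature x - q [x] \<in> V 1" "G.push x - g1 x \<in> W 0" "f1 y - q [K v] \<in> V 0"
  "K (F.Q.curvature x - q [x]) \<in> V 0" "f1 (G.push x - g1 x) \<in> V 0" "f1 y \<in> V 0" "q [K v] \<in> V 0"
proof -
  show "F.Q.curvature x - q [x] \<in> V 1"
    using F.Q.curvature_mem[OF x] q_mem[OF x]
    by (intro F.Q.S.subspace_diff F.Q.S.subspace_component) auto
  then show "K (F.Q.curvature x - q [x]) \<in> V 0"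
    using K_mem by fastforce
  show "G.push x - g1 x \<in> W 0"
    using G.exp_apply_mem[OF x] g1_mem[OF x]
    by (intro F.R.S.subspace_diff F.R.S.subspace_component)
  then show "f1 (G.push x - g1 x) \<in> V 0"
    by (rule f1_mem)
  show "f1 y \<in> V 0" "q [K v] \<in> V 0"
    using f1_mem[OF y] q_mem[OF K_mem[OF v]] by auto
  then show "f1 y - q [K v] \<in> V 0"
    by (intro F.Q.S.subspace_diff F.Q.S.subspace_component)
qed

lemma fixed_point_eq: "x = f1 y - q [K v] + (K (F.Q.curvature x - q [x]) - f1 (G.push x - g1 x))"
  using step_eq[OF x, of y "K v"] fixed by simp

text \<open>Apply \<open>K\<close> to the fixed point equation. \<open>K f1\<close> and
  \<open>K K\<close> vanish, and \<open>- K (q [K v])\<close> equals \<open>K v\<close>.\<close>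

lemma fixed_point_K: "K x = K v"
proof -
  note m = fixed_point_mems
  have "K x = K (f1 y) - K (q [K v]) + (K (K (F.Q.curvature x - q [x])) - K (f1 (G.push x - g1 x)))"
    using K_add[OF m(3) F.Q.S.subspace_diff[OF F.Q.S.subspace_component m(4,5)]]
      K_diff[OF m(6,7)] K_diff[OF m(4,5)] fixed_point_eq by simp
  then show ?thesis
    using K_f1[OF y] q_Kv(1)[OF v] K_K[OF m(1)] K_f1[OF m(2)] by simp
qed

text \<open>Applying \<open>g1\<close> to the fixed point equation leaves
  \<open>g1 x = y - (G.push x - g1 x)\<close>.\<close>

lemma fixed_point_push: "G.push x = y"
proof -
  note m = fixed_point_mems
  have "g1 x = g1 (f1 y) - g1 (q [K v]) + (g1 (K (F.Q.curvature x - q [x])) - g1 (f1 (G.push x - g1 x)))"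
    using g1_add[OF m(3) F.Q.S.subspace_diff[OF F.Q.S.subspace_component m(4,5)]]
      g1_diff[OF m(6,7)] g1_diff[OF m(4,5)] fixed_point_eq by simp
  then show ?thesis
    using g1_f1[OF y] q_Kv(2)[OF v] g1_K[OF m(1)] g1_f1[OF m(2)] by simp
qed

text \<open>After substituting \<open>y\<close> for \<open>G.push x\<close> and rewriting
  \<open>f1 (g1 x)\<close> by the homotopy formula, the fixed point equation reads
  \<open>x = x + K (F.Q.curvature x)\<close>.\<close>

lemma fixed_point_K_curvature: "K (F.Q.curvature x) = 0"
proof -
  have 1: "K (F.Q.curvature x - q [x]) = K (F.Q.curvature x) - K (q [x])"
    using K_diff[OF F.Q.curvature_mem[OF x], of "q [x]"] q_mem[OF x] by simp
  have 2: "f1 (G.push x - g1 x) = f1 y - f1 (g1 x)"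
    using f1_diff[OF y g1_mem[OF x]] fixed_point_push by simp
  have 3: "f1 (g1 x) = x + (K (q [x]) + q [K v])"
    using homotopy[OF x] fixed_point_K by simp
  have "f1 y - q [K v] + (K (F.Q.curvature x - q [x]) - f1 (G.push x - g1 x)) =
      x + K (F.Q.curvature x)"
    by (simp add: 1 2 3)
  then show ?thesis
    using fixed_point_eq by simp
qed

text \<open>Both terms that express the curvature gain a filtration step: \<open>g1\<close> of it
  because \<open>y\<close> has curvature 0, and \<open>q\<close> of it by the Bianchi identity.
  Induction puts it into every \<open>F p\<close>.\<close>

lemma fixed_point_curvature:
  assumes "F.R.curvature y = 0"
  shows "F.Q.curvature x = 0"
proof (rule F.Q.S.eq_zero_if_mem_filtration)
  let ?c = "F.Q.curvature x"
  have c: "?c \<in> V 1"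
    by (rule F.Q.curvature_mem[OF x])
  have zero: "q [0] = 0"
    using F.Q.zero_letter[of "[]" "[]"] by simp
  \<comment> \<open>The homotopy formula at the curvature, where \<open>q [K c]\<close> drops out
    since \<open>K c = 0\<close>.\<close>
  have eq: "?c = f1 (g1 ?c) - K (q [?c])"
    using homotopy[OF c] fixed_point_K_curvature zero by (simp add: algebra_simps)
  fix p :: nat assume "1 \<le> p"
  then show "?c \<in> FV p 1"
  proof (induction p rule: nat_induct_at_least)
    case base
    then show ?case
      using c F.Q.S.filtration_one by simp
  next
    case (Suc p)
    have "g1 ?c \<in> FW (Suc p) 1"
      using G.linear_part_curvature_mem_filtration[OF x _ Suc] fixed_point_push assms
        g_linear_part[OF c] by simp
    moreover have "K (q [?c]) \<in> FV (Suc p) 1"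
      using K_filtration[OF _ F.Q.coderivation_curvature_mem_filtration[OF x Suc]] by simp
    ultimately have "f1 (g1 ?c) - K (q [?c]) \<in> FV (Suc p) 1"
      by (intro F.Q.S.subspace_diff F.Q.S.subspace_filtration f1_filtration) auto
    then show ?case
      using eq by simp
  qed
qed

end

text \<open>The sequence is a parameter so that the lemma serves both the surjectivity proof and the
  recursion \<open>MC_iteration\<close>.\<close>

lemma iteration_tendsto:
  assumes y: "y \<in> MC_W" and v: "v \<in> V 0"
    and X: "X 0 = 0" "\<And>n. X (Suc n) = step y (K v) (X n)"
  obtains x where "x \<in> MC_V" "G.push x = y" "K x = K v" "filt_tendsto FV 0 X x"
proof -
  have u: "K v \<in> V (- 1)"
    using K_mem[OF v] by simp
  obtain x where x: "x \<in> V 0" "step y (K v) x = x" "filt_tendsto FV 0 X x"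
  proof (rule F.Q.S.contraction_fixed_point[of 0 "step y (K v)" X])
    show "step y (K v) x \<in> V 0" if "x \<in> V 0" for x
      using step_mem[OF _ u that] y by simp
  qed (use step_contracting X in auto)
  then show ?thesis
    using that[of x] fixed_point_curvature[OF x(1) _ v x(2)] fixed_point_K[OF x(1) _ v x(2)]
      fixed_point_push[OF x(1) _ v x(2)] y by simp
qed

text \<open>Elements with equal coordinates are fixed points of the same contraction.\<close>

lemma MC_eqI:
  assumes "x \<in> MC_V" "x' \<in> MC_V" "G.push x = G.push x'" "K x = K x'"
  shows "x = x'"
proof (rule F.Q.S.contraction_fixed_point_unique[of 0 "step (G.push x) (K x)"])
  show "step (G.push x) (K x) x = x" "step (G.push x) (K x) x' = x'"
    using step_fixes_MC[of x] step_fixes_MC[of x'] assms by simp_all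
  show "step (G.push x) (K x) z - step (G.push x) (K x) z' \<in> FV (Suc p) 0"
    if "1 \<le> p" "z \<in> V 0" "z' \<in> V 0" "z - z' \<in> FV p 0" for p z z'
    by (rule step_contracting[OF that])
  show "x \<in> V 0" "x' \<in> V 0"
    using assms by blast+
qed

lemma bij_betw_MC: "bij_betw (\<lambda>x. (G.push x, K x)) MC_V (MC_W \<times> K ` V 0)"
proof (intro bij_betw_imageI inj_onI equalityI subsetI)
  fix x x' assume "x \<in> MC_V" "x' \<in> MC_V" "(G.push x, K x) = (G.push x', K x')"
  then show "x = x'"
    using MC_eqI by blast
next
  fix z assume "z \<in> (\<lambda>x. (G.push x, K x)) ` MC_V"
  then show "z \<in> MC_W \<times> K ` V 0"
    using G.exp_apply_mem G.curvature_push_eq_zero by auto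
next
  fix z assume "z \<in> MC_W \<times> K ` V 0"
  then obtain y v where z: "z = (y, K v)" "y \<in> MC_W" "v \<in> V 0"
    by auto
  obtain x where "x \<in> MC_V" "G.push x = y" "K x = K v"
    using iteration_tendsto[OF z(2,3), of "\<lambda>n. (step y (K v) ^^ n) 0"] by auto
  then show "z \<in> (\<lambda>x. (G.push x, K x)) ` MC_V"
    using z(1) by (auto intro!: image_eqI[of _ _ x])
qed

section \<open>Maurer-Cartan elements in the kernel of \<open>K\<close>\<close>

lemma push_eq_linear_part:
  assumes "x \<in> V 0" "K x = 0"
  shows "G.push x = g1 x"
  using G.exp_apply_split_first[OF assms(1)] g_linear_part[OF assms(1)]
    F.R.S.filt_sum_zero[of 2 "\<lambda>i. sW (1 / fact i) (g (replicate i x))"] g_eq_zero[OF assms]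
  by simp

text \<open>All terms of \<open>F.push y\<close> beyond \<open>f1 y\<close> lie in the image of
  \<open>K\<close>, where \<open>K\<close> and \<open>g1\<close> vanish; by continuity so does their
  sum. Once \<open>K (F.push y) = 0\<close> is known, \<open>G.push\<close> acts on it as
  \<open>g1\<close>.\<close>

lemma push_inverse:
  assumes y: "y \<in> W 0"
  shows "K (F.push y) = 0" "G.push (F.push y) = y"
proof -
  let ?f = "\<lambda>i. sV (1 / fact i) (f (replicate i y))"
  have f: "?f i \<in> FV i 0" if "2 \<le> i" for i
    using F.exp_term_mem[OF y] that by auto
  have fV: "f (replicate i y) \<in> V 0" if "2 \<le> i" for i
    using F.mem_component[of "replicate i (0, y)"] y that by auto
  have s: "filt_sum FV 0 2 ?f \<in> V 0"
    by (rule F.Q.S.filt_sum_mem[OF _ f]) auto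
  have push: "F.push y = f1 y + filt_sum FV 0 2 ?f"
    using F.exp_apply_split_first[OF y] f_linear_part[OF y] by simp
  have "K (?f i) = 0" "g1 (?f i) = 0" if i: "2 \<le> i" for i
  proof -
    obtain u where "u \<in> V 1" "f (replicate i y) = K u"
      using f_mem_image[OF y i] by auto
    then show "K (?f i) = 0" "g1 (?f i) = 0"
      using K_scale[OF fV[OF i]] g1_scale[OF fV[OF i]] K_K g1_K by simp_all
  qed
  moreover have "K (filt_sum FV 0 2 ?f) = filt_sum FV (- 1) 2 (\<lambda>i. K (?f i))"
    using f K_add[of _ 0] K_filtration[of _ _ 0]
    by (intro F.Q.S.filt_sum_linear[OF _ _ F.Q.S.complete_space_axioms]) auto
  moreover have "g1 (filt_sum FV 0 2 ?f) = filt_sum FW 0 2 (\<lambda>i. g1 (?f i))"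
    using f g1_add[of _ 0] g1_filtration[of _ _ 0]
    by (intro F.Q.S.filt_sum_linear[OF _ _ F.R.S.complete_space_axioms]) auto
  ultimately have "K (filt_sum FV 0 2 ?f) = 0" "g1 (filt_sum FV 0 2 ?f) = 0"
    using F.Q.S.filt_sum_zero F.R.S.filt_sum_zero by simp_all
  then have "K (F.push y) = 0" "g1 (F.push y) = y"
    using push K_add[OF f1_mem[OF y] s] g1_add[OF f1_mem[OF y] s] K_f1[OF y] g1_f1[OF y] by simp_all
  then show "K (F.push y) = 0" "G.push (F.push y) = y"
    using push_eq_linear_part[OF F.exp_apply_mem[OF y]] by simp_all
qed

lemma push_mem_MC: "y \<in> MC_W \<Longrightarrow> F.push y \<in> MC_V"
  by (simp add: F.exp_apply_mem F.curvature_push_eq_zero)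

text \<open>\<open>F.push (g1 x)\<close> and \<open>x\<close> both have coordinates
  \<open>(g1 x, 0)\<close>, so injectivity identifies them.\<close>

lemma push_linear_part:
  assumes "x \<in> MC_V" "K x = 0"
  shows "g1 x \<in> MC_W" "F.push (g1 x) = x"
proof -
  have eq: "G.push x = g1 x"
    using push_eq_linear_part assms by auto
  then show mem: "g1 x \<in> MC_W"
    using assms G.exp_apply_mem[of x] G.curvature_push_eq_zero[of x] by auto
  then have W: "g1 x \<in> W 0"
    by simp
  show "F.push (g1 x) = x"
    using push_inverse[OF W] eq assms(2) by (intro MC_eqI[OF push_mem_MC[OF mem] assms(1)]) simp_all
qed

lemma bij_betw_MC_kernel: "bij_betw F.push MC_W ({x \<in> V 0. K x = 0} \<inter> MC_V)"
proof (rule bij_betw_byWitness[where f' = g1])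
  show "\<forall>y\<in>MC_W. g1 (F.push y) = y"
    using push_inverse push_eq_linear_part F.exp_apply_mem by auto
  show "\<forall>x\<in>{x \<in> V 0. K x = 0} \<inter> MC_V. F.push (g1 x) = x"
    using push_linear_part by auto
  show "F.push ` MC_W \<subseteq> {x \<in> V 0. K x = 0} \<inter> MC_V"
    using push_mem_MC push_inverse by auto
  show "g1 ` ({x \<in> V 0. K x = 0} \<inter> MC_V) \<subseteq> MC_W"
    using push_linear_part by auto
qed

end

section \<open>From the definitions to the shifted spaces\<close>

text \<open>The zero letter either stays in the word or is fed to \<open>r\<close>, whose value is
  then a zero letter. In both cases \<open>f\<close> meets a zero letter.\<close>

lemma (in filtered_coalgebra_morphism) lin_ext_coder_part_eq_zero:
  assumes ws: "ws \<in> words W" "(d, 0) \<in> set ws" and i: "1 \<le> i" "i \<le> length ws"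
  shows "lin_ext sV (\<lambda>w. f (map snd w)) (coder_part r i ws) = 0"
  unfolding coder_part_def Q.S.lin_ext_sum
proof (rule sum.neutral, rule ballI)
  fix \<sigma> assume "\<sigma> \<in> unshuffles [i, length ws - i]"
  then have \<sigma>: "\<sigma> permutes {..<length ws}"
    using unshuffles_permutes i by fastforce
  let ?us = "permute_list \<sigma> ws"
  let ?w = "(deg (take i ?us) + 1, r (map snd (take i ?us))) # drop i ?us"
  have us: "?us \<in> words W" "(d, 0) \<in> set ?us"
    using ws set_permute_list[OF \<sigma>] by (simp_all add: words_def)
  then have split: "(d, 0) \<in> set (take i ?us) \<or> (d, 0) \<in> set (drop i ?us)"
    by (metis append_take_drop_id set_append Un_iff)
  have words: "take i ?us \<in> words W" "drop i ?us \<in> words W"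
    using us(1) by (metis append_take_drop_id words_append)+
  have "length (take i ?us) \<noteq> 0"
    using i by simp
  then have "take i ?us \<noteq> []"
    by (simp only: length_0_conv not_False_eq_True)
  then have "?w \<in> words W"
    using R.mem_component[OF words(1)] words(2) by simp
  moreover have "(deg (take i ?us) + 1, 0) \<in> set ?w \<or> (d, 0) \<in> set ?w"
    using split R.eq_zero_if_zero_letter[OF words(1)] by auto
  ultimately have "f (map snd ?w) = 0"
    using eq_zero_if_zero_letter by blast
  then show "lin_ext sV (\<lambda>w. f (map snd w)) (let us = ?us in
      Poly_Mapping.single ((deg (take i us) + 1, r (map snd (take i us))) # drop i us)
        (koszul_sign ws \<sigma>)) = 0"
    by (simp add: Q.S.lin_ext_single Let_def)
qed

lemma complete_filtration_shift:
  "complete_filtration s V F \<Longrightarrow> complete_filtration s (shift V) (\<lambda>p. shift (F p))"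
  by (simp add: complete_filtration_def shift_def fun_eq_iff)

lemma filt_tendsto_shift: "filt_tendsto (\<lambda>p. shift (F p)) k = filt_tendsto F (k + 1)"
  by (simp add: filt_tendsto_def shift_def fun_eq_iff)

lemma filt_sum_shift: "filt_sum (\<lambda>p. shift (F p)) k = filt_sum F (k + 1)"
  by (simp add: filt_sum_def filt_tendsto_shift fun_eq_iff) (simp add: shift_def)

lemma pullback_filtration_shift:
  "(\<lambda>p. shift (pullback_filtration W F f p)) = pullback_filtration (shift W) (\<lambda>p. shift (F p)) f"
  by (simp add: pullback_filtration_def shift_def fun_eq_iff)

lemma complete_space_shift:
  assumes "complete_Linf_algebra s V F q"
  shows "complete_space s (shift V) (\<lambda>p. shift (F p))"
proof -
  interpret vector_space s
    using assms by (simp add: complete_Linf_algebra_def Linf_algebra_def graded_space_def)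
  show ?thesis
    using assms complete_filtration_shift by unfold_locales (auto simp: complete_Linf_algebra_def)
qed

lemma filtered_multilinear_mapI:
  assumes "complete_space sV V F" "complete_space sW W F'"
    and "sym_family sV V sW W e m" "filtered_family V F F' e m"
  shows "filtered_multilinear_map sV V F sW W F' e m"
  using assms
  unfolding filtered_multilinear_map_def filtered_multilinear_map_axioms_def sym_family_def
  by blast

lemma filtered_coderivation_shift:
  assumes "complete_Linf_algebra s V F q"
  shows "filtered_coderivation s (shift V) (\<lambda>p. shift (F p)) q"
proof -
  interpret filtered_multilinear_map s "shift V" "\<lambda>p. shift (F p)" s "shift V" "\<lambda>p. shift (F p)" 1 q
    using assms complete_space_shift[OF assms]
    by (intro filtered_multilinear_mapI) (auto simp: complete_Linf_algebra_def Linf_algebra_def)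
  show ?thesis
    using assms by unfold_locales (auto simp: complete_Linf_algebra_def Linf_algebra_def)
qed

lemma filtered_coalgebra_morphism_shift:
  assumes "complete_Linf_algebra sW W FW r" "complete_Linf_algebra sV V FV q"
    and "continuous_Linf_morphism sW W FW r sV V FV q f"
  shows "filtered_coalgebra_morphism sW (shift W) (\<lambda>p. shift (FW p)) r sV (shift V) (\<lambda>p. shift (FV p)) q f"
proof -
  interpret R: filtered_coderivation sW "shift W" "\<lambda>p. shift (FW p)" r
    by (rule filtered_coderivation_shift[OF assms(1)])
  interpret Q: filtered_coderivation sV "shift V" "\<lambda>p. shift (FV p)" q
    by (rule filtered_coderivation_shift[OF assms(2)])
  interpret filtered_multilinear_map sW "shift W" "\<lambda>p. shift (FW p)" sV "shift V" "\<lambda>p. shift (FV p)" 0 f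
    using assms(3) R.S.complete_space_axioms Q.S.complete_space_axioms
    by (intro filtered_multilinear_mapI) (auto simp: continuous_Linf_morphism_def Linf_morphism_def)
  show ?thesis
    using assms(3) by unfold_locales (auto simp: continuous_Linf_morphism_def Linf_morphism_def)
qed

lemma MC_eq_curvature_zero:
  assumes "complete_Linf_algebra s V F q"
  shows "MC s V F q = {x \<in> shift V 0. exp_apply s (\<lambda>p. shift (F p)) 1 q x = 0}"
proof -
  interpret filtered_coderivation s "shift V" "\<lambda>p. shift (F p)" q
    by (rule filtered_coderivation_shift[OF assms])
  have "x \<in> MC s V F q \<longleftrightarrow> x \<in> shift V 0 \<and> curvature x = 0" for x
    using exp_apply_eq_zero_iff[of x] by (auto simp: MC_def filt_tendsto_shift) (auto simp: shift_def)
  then show ?thesis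
    by blast
qed

lemma MC_map_eq_exp_apply: "MC_map s F f = exp_apply s (\<lambda>p. shift (F p)) 0 f"
  by (simp add: MC_map_def exp_apply_def filt_sum_shift fun_eq_iff)

text \<open>By linearity \<open>K\<close> can be pulled out of the recursion for \<open>f\<close>.
  The remaining argument has degree 1, as \<open>q\<close> is evaluated on letters of degree
  0.\<close>

lemma homotopy_transfer_mem_image:
  assumes "filtered_coalgebra_morphism sW (shift W) FW r sV (shift V) FV q f"
    and "complete_contraction sV (shift V) FV (\<lambda>v. q [v]) sW (shift W) dW f1 g1 K"
    and "homotopy_transfer sV V q sW W dW f1 g1 K r f g"
    and y: "y \<in> shift W 0" "2 \<le> i"
  shows "f (replicate i y) \<in> K ` shift V 1"
proof -
  interpret filtered_coalgebra_morphism sW "shift W" FW r sV "shift V" FV q f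
    by fact
  let ?ws = "replicate i (0 :: int, y)"
  let ?u = "\<lambda>k. sym_apply sV q (mor_comp f k ?ws)"
  have K: "graded_linear sV (shift V) sV (shift V) (- 1) K"
    using assms(2) by (simp add: complete_contraction_def)
  have u: "?u k \<in> shift V 1" if k: "1 \<le> k" for k
    unfolding sym_apply_def lin_ext_mor_comp_replicate[OF Q.S.vector_space_axioms]
  proof (intro Q.S.subspace_sum Q.S.subspace_scale Q.S.subspace_component)
    fix js assume js: "js \<in> compositions k i"
    then have "f (replicate n y) \<in> shift V 0" if "n \<in> set js" for n
      using mem_component[of "replicate n (0, y)"] y that by (auto simp: compositions_def)
    then have "map (\<lambda>n. (0, f (replicate n y))) js \<in> words (shift V)"
      by (auto simp: words_def)
    moreover have "js \<noteq> []"
      using js k by (auto simp: compositions_def)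
    ultimately show "q (map snd (map (\<lambda>n. (0 :: int, f (replicate n y))) js)) \<in> shift V 1"
      using Q.mem_component[of "map (\<lambda>n. (0, f (replicate n y))) js"]
      by (simp add: deg_def o_def)
  qed
  have "\<forall>ws\<in>words (shift W). 2 \<le> length ws \<longrightarrow>
      f (map snd ws) = (\<Sum>k=2..length ws. K (sym_apply sV q (mor_comp f k ws)))"
    using assms(3) unfolding homotopy_transfer_def by blast
  from bspec[OF this, of ?ws] have "f (map snd ?ws) = (\<Sum>k=2..length ?ws. K (?u k))"
    using y by simp
  also have "\<dots> = K (\<Sum>k=2..length ?ws. ?u k)"
    by (rule graded_linear_sum[OF K Q.S.vector_space_axioms Q.S.vector_space_axioms
          Q.S.subspace_component[of 1], symmetric]) (use u in simp)
  finally show ?thesis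
    using u by (auto intro!: Q.S.subspace_sum Q.S.subspace_component)
qed

text \<open>Every word in \<open>K\<^sub>i(x\<^sup>\<odot>\<^sup>i)\<close> contains the letter \<open>K x = 0\<close>.\<close>

lemma homotopy_transfer_eq_zero:
  assumes "filtered_coalgebra_morphism sV (shift V) FV q sW (shift W) FW r g"
    and contr: "complete_contraction sV (shift V) FV (\<lambda>v. q [v]) sW (shift W) dW f1 g1 K"
    and "homotopy_transfer sV V q sW W dW f1 g1 K r f g"
    and x: "x \<in> shift V 0" "K x = 0" "2 \<le> i"
  shows "g (replicate i x) = 0"
proof -
  interpret filtered_coalgebra_morphism sV "shift V" FV q sW "shift W" FW r g
    by fact
  let ?vs = "replicate i (0 :: int, x)" and ?h = "\<lambda>v. f1 (g1 v)"
  have h: "?h x \<in> shift V 0"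
    using contr x(1) by (simp add: complete_contraction_def graded_linear_def)
  have "lin_ext sW (\<lambda>w. lin_ext sW (\<lambda>w. g (map snd w)) (coder_comp q k w)) (sym_homotopy ?h K ?vs) = 0"
    if k: "k \<in> {1..i - 1}" for k
    unfolding sym_homotopy_def Q.S.lin_ext_sum
  proof (intro sum.neutral ballI)
    fix \<sigma> j assume "\<sigma> \<in> {\<sigma>. \<sigma> permutes {..<length ?vs}}" and j: "j \<in> {..<length ?vs}"
    then have us: "permute_list \<sigma> ?vs = ?vs"
      by (simp add: permute_list_replicate)
    let ?w = "map (apsnd ?h) (take j ?vs) @ (fst (?vs ! j) - 1, K (snd (?vs ! j))) # drop (Suc j) ?vs"
    have "?w \<in> words (shift V)" "(- 1, 0) \<in> set ?w" "length ?w = i"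
      using j x h R.S.zero_mem_component by auto
    \<comment> \<open>The component with index \<open>k\<close> uses the bracket of arity
      \<open>i + 1 - k\<close>, which lies between 2 and \<open>i\<close> for
      \<open>1 \<le> k \<le> i - 1\<close>.\<close>
    then have "lin_ext sW (\<lambda>w. g (map snd w)) (coder_comp q k ?w) = 0"
      unfolding coder_comp_def using k by (intro lin_ext_coder_part_eq_zero[of _ "- 1"]) auto
    then show "lin_ext sW (\<lambda>w. lin_ext sW (\<lambda>w. g (map snd w)) (coder_comp q k w))
        (let us = permute_list \<sigma> ?vs in Poly_Mapping.single
          (map (apsnd ?h) (take j us) @ (fst (us ! j) - 1, K (snd (us ! j))) # drop (Suc j) us)
          (koszul_sign ?vs \<sigma> * (if odd (deg (take j us)) then - 1 else 1) / fact (length ?vs))) = 0"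
      unfolding us Let_def Q.S.lin_ext_single by simp
  qed
  note eq = this
  have "\<forall>vs\<in>words (shift V). 2 \<le> length vs \<longrightarrow>
      g (map snd vs) = (\<Sum>k=1..length vs - 1. sym_apply sW g
        (lin_ext tscale (coder_comp q k) (sym_homotopy ?h K vs)))"
    using assms(3) unfolding homotopy_transfer_def by blast
  from bspec[OF this, of ?vs] have "g (map snd ?vs) = (\<Sum>k=1..length ?vs - 1. sym_apply sW g
      (lin_ext tscale (coder_comp q k) (sym_homotopy ?h K ?vs)))"
    using x by simp
  then show ?thesis
    using eq by (simp add: sym_apply_def Q.S.lin_ext_lin_ext)
qed

theorem theorem1p13:
  fixes sV :: "'k::field_char_0 \<Rightarrow> 'v::ab_group_add \<Rightarrow> 'v"
    and sW :: "'k \<Rightarrow> 'w::ab_group_add \<Rightarrow> 'w"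
    and V :: "int \<Rightarrow> 'v set" and W :: "int \<Rightarrow> 'w set"
    and FV :: "nat \<Rightarrow> int \<Rightarrow> 'v set" and FW :: "nat \<Rightarrow> int \<Rightarrow> 'w set"
    and q :: "'v list \<Rightarrow> 'v" and dW :: "'w \<Rightarrow> 'w"
    and f1 :: "'w \<Rightarrow> 'v" and g1 :: "'v \<Rightarrow> 'w" and K :: "'v \<Rightarrow> 'v"
    and r :: "'w list \<Rightarrow> 'w" and f :: "'w list \<Rightarrow> 'v" and g :: "'v list \<Rightarrow> 'w"
  defines "FW \<equiv> pullback_filtration W FV f1"
  defines "\<rho> \<equiv> \<lambda>x. (MC_map sW FW g x, K x)"
  defines "\<rho>_inv \<equiv> inv_into (MC sV V FV q) \<rho>"
  assumes "complete_Linf_algebra sV V FV q"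
    and "complete_contraction sV (shift V) (\<lambda>p. shift (FV p)) (\<lambda>v. q [v])
           sW (shift W) dW f1 g1 K"
    and "homotopy_transfer sV V q sW W dW f1 g1 K r f g"
    and "complete_Linf_algebra sW W FW r"
    and "continuous_Linf_morphism sW W FW r sV V FV q f"
    and "continuous_Linf_morphism sV V FV q sW W FW r g"
  shows "bij_betw \<rho> (MC sV V FV q) (MC sW W FW r \<times> K ` V 1) \<and>
         (\<forall>y\<in>MC sW W FW r. \<forall>v\<in>V 1.
           (\<forall>n. MC_iteration sV FV q f1 K g y (K v) n \<in> V 1) \<and>
           (\<exists>!x. x \<in> V 1 \<and> filt_tendsto FV 1 (MC_iteration sV FV q f1 K g y (K v)) x) \<and>
           (\<forall>x\<in>V 1. filt_tendsto FV 1 (MC_iteration sV FV q f1 K g y (K v)) x \<longrightarrow>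
              \<rho>_inv (y, K v) = x)) \<and>
         (\<forall>y\<in>MC sW W FW r. \<rho>_inv (y, 0) = MC_map sV FV f y) \<and>
         bij_betw (MC_map sV FV f) (MC sW W FW r) ({x \<in> V 1. K x = 0} \<inter> MC sV V FV q) \<and>
         (\<forall>x\<in>{x \<in> V 1. K x = 0} \<inter> MC sV V FV q.
           inv_into (MC sW W FW r) (MC_map sV FV f) x = g1 x)"
proof -
  have FW: "(\<lambda>p. shift (FW p)) = pullback_filtration (shift W) (\<lambda>p. shift (FV p)) f1"
    unfolding FW_def by (rule pullback_filtration_shift)
  note F = filtered_coalgebra_morphism_shift[OF assms(7,4,8)]
  note G = filtered_coalgebra_morphism_shift[OF assms(4,7,9)]
  interpret contraction_transfer sV "shift V" "\<lambda>p. shift (FV p)" q sW "shift W" r dW f1 g1 K f g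
  proof (intro contraction_transfer.intro contraction_transfer_axioms.intro)
    show "f [y] = f1 y" if "y \<in> shift W 0" for y
      using assms(6) that by (auto simp: homotopy_transfer_def)
    show "g [x] = g1 x" if "x \<in> shift V k" for x k
      using assms(6) that by (auto simp: homotopy_transfer_def)
  qed (use F G assms(5) homotopy_transfer_mem_image[OF F assms(5,6)]
        homotopy_transfer_eq_zero[OF G assms(5,6)] in \<open>simp_all add: FW\<close>)
  have V1: "shift V 0 = V 1"
    by (simp add: shift_def)
  have MC_V: "MC sV V FV q = MC_V" and MC_W: "MC sW W FW r = MC_W"
    by (simp_all add: MC_eq_curvature_zero[OF assms(4)] MC_eq_curvature_zero[OF assms(7)] FW)
  have \<rho>: "\<rho> = (\<lambda>x. (G.push x, K x))"
    by (simp add: \<rho>_def MC_map_eq_exp_apply FW)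
  have map_f: "MC_map sV FV f = F.push"
    by (rule MC_map_eq_exp_apply)
  have inv: "\<rho>_inv (G.push x, K x) = x" if "x \<in> MC_V" for x
    using inv_into_f_f[OF bij_betw_imp_inj_on[OF bij_betw_MC] that]
    by (simp add: \<rho>_inv_def MC_V \<rho>)
  have iteration: "(\<forall>n. MC_iteration sV FV q f1 K g y (K v) n \<in> V 1) \<and>
      (\<exists>!x. x \<in> V 1 \<and> filt_tendsto FV 1 (MC_iteration sV FV q f1 K g y (K v)) x) \<and>
      (\<forall>x\<in>V 1. filt_tendsto FV 1 (MC_iteration sV FV q f1 K g y (K v)) x \<longrightarrow> \<rho>_inv (y, K v) = x)"
    if y: "y \<in> MC_W" and v: "v \<in> V 1" for y v
  proof -
    let ?X = "MC_iteration sV FV q f1 K g y (K v)"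
    \<comment> \<open>Up to the shift of degrees by one, the recursion is the orbit of 0 under
      \<open>step\<close>.\<close>
    have X: "?X 0 = 0" "?X (Suc n) = step y (K v) (?X n)" for n
      by (simp_all add: step_def higher_def filt_sum_shift)
    have v': "v \<in> shift V 0"
      using v by (simp add: V1)
    have "?X n \<in> shift V 0" for n
    proof (induction n)
      case 0
      then show ?case
        by simp
    next
      case (Suc n)
      then show ?case
        unfolding X(2) using y K_mem[OF v'] by (intro step_mem) auto
    qed
    moreover obtain x where x: "x \<in> MC_V" "G.push x = y" "K x = K v"
        and lim: "filt_tendsto FV 1 ?X x"
      using iteration_tendsto[OF y v' X] by (auto simp: filt_tendsto_shift)
    moreover have unique: "x' = x" if "filt_tendsto FV 1 ?X x'" for x'
      using F.Q.S.filt_tendsto_unique[of 0 ?X x' x] that lim by (simp add: filt_tendsto_shift)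
    moreover have "\<rho>_inv (y, K v) = x"
      using inv[OF x(1)] x by simp
    ultimately show ?thesis
      unfolding V1 by blast
  qed
  \<comment> \<open>\<open>F.push y\<close> is a Maurer-Cartan element with coordinates
    \<open>(y, 0)\<close>.\<close>
  have zero: "\<rho>_inv (y, 0) = F.push y" if "y \<in> MC_W" for y
    using inv[OF push_mem_MC[OF that]] push_inverse[of y] that by simp
  have kernel: "inv_into MC_W F.push x = g1 x" if "x \<in> {x \<in> V 1. K x = 0} \<inter> MC_V" for x
    using push_linear_part[of x] that
      inv_into_f_f[OF bij_betw_imp_inj_on[OF bij_betw_MC_kernel], of "g1 x"] by simp
  show ?thesis
    using bij_betw_MC bij_betw_MC_kernel iteration zero kernel
    unfolding MC_V MC_W \<rho> map_f V1 by blast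
qed

end
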